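(* Let $G$ be a three-dimensional Lie group of Bianchi type $IX$, $VIII$, $II$, $VII_0$ or $VI_0$, with a basis of left-invariant 1-forms $e^1,e^2,e^3$ satisfying the structure equations listed in the context for its type. Let $f_1,f_2,f_3,f$ be nowhere vanishing functions of $t$ in an interval $I\subset\mathbb{R}$. The diagonal almost hyper-parahermitian structure on $G\times I$ determined by $(f_1,f_2,f_3,f)$ (see context) is hyper-symplectic exactly when the system of ODEs given below for the type of $G$ holds, and the general solution of that system is the one given below. Here $a_1,a_2,a_3,a,b,c$ are constants, and $x$ (respectively $r$ for type $II$) is an auxiliary independent variable: substituting any function $x=x(t)$ (respectively $r=r(t)$) gives a solution in terms of $t$ in an interval where $f,f_1,f_2,f_3$ do not vanish. The quantities raised to fractional powers are taken positive as indicated. - Type $IX$: system $\frac{d}{dt}(f_1f_2)=-ff_3$, $\frac{d}{dt}(f_1f_3)=ff_2$, $\frac{d}{dt}(f_2f_3)=ff_1$. General solution: $f_1=\frac{(x-a_2)^{1/4}(a_3-x)^{1/4}}{(x-a_1)^{1/4}}$, $f_2=\frac{(x-a_1)^{1/4}(a_3-x)^{1/4}}{(x-a_2)^{1/4}}$, $f_3=\frac{(x-a_1)^{1/4}(x-a_2)^{1/4}}{(a_3-x)^{1/4}}$, $f=\frac12\big((x-a_1)(x-a_2)(a_3-x)\big)^{-1/4}x'(t)$, with $x-a_1,\,x-a_2,\,a_3-x>0$. - Type $VIII$: system $\frac{d}{dt}(f_1f_2)=ff_3$, $\frac{d}{dt}(f_1f_3)=ff_2$, $\frac{d}{dt}(f_2f_3)=ff_1$.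 General solution: $f_i=\frac{(x-a_j)^{1/4}(x-a_k)^{1/4}}{(x-a_i)^{1/4}}$ for $(i,j,k)$ any cyclic permutation of $(1,2,3)$, $f=\frac12\big((x-a_1)(x-a_2)(x-a_3)\big)^{-1/4}x'(t)$, with $x-a_1,\,x-a_2,\,x-a_3>0$. - Type $II$: system $\frac{d}{dt}(f_1f_2)=-ff_3$, $\frac{d}{dt}(f_1f_3)=0$, $\frac{d}{dt}(f_2f_3)=0$. General solution: with $u=\frac32(ab)^{1/4}r+c$, $f_1=\left(\frac ba\right)^{1/4}u^{1/3}$, $f_2=\left(\frac ab\right)^{1/4}u^{1/3}$, $f_3=-(ab)^{1/4}u^{-1/3}$, $f=r'(t)$, with $a,b,u>0$. - Type $VII_0$: system $\frac{d}{dt}(f_1f_2)=-ff_3$, $\frac{d}{dt}(f_1f_3)=ff_2$, $\frac{d}{dt}(f_2f_3)=0$. General solution: $f_1=\frac{(x-a_2)^{1/4}(a_3-x)^{1/4}}{a_1^{1/4}}$, $f_2=\frac{a_1^{1/4}(a_3-x)^{1/4}}{(x-a_2)^{1/4}}$, $f_3=\frac{a_1^{1/4}(x-a_2)^{1/4}}{(a_3-x)^{1/4}}$, $f=\frac12\big(a_1(x-a_2)(a_3-x)\big)^{-1/4}x'(t)$, with $a_1,\,x-a_2,\,a_3-x>0$. - Type $VI_0$: system $\frac{d}{dt}(f_1f_2)=ff_3$, $\frac{d}{dt}(f_1f_3)=ff_2$, $\frac{d}{dt}(f_2f_3)=0$. General solution: $f_1=\frac{(x-a_2)^{1/4}(x-a_3)^{1/4}}{a_1^{1/4}}$,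 $f_2=\frac{a_1^{1/4}(x-a_3)^{1/4}}{(x-a_2)^{1/4}}$, $f_3=\frac{a_1^{1/4}(x-a_2)^{1/4}}{(x-a_3)^{1/4}}$, $f=\frac12\big(a_1(x-a_2)(x-a_3)\big)^{-1/4}x'(t)$, with $a_1,\,x-a_2,\,x-a_3>0$. The resulting hyper-symplectic metric, which is the general triaxial (diagonal) one obtained in this way, is $$g=f_1^2(e^1)^2+f_2^2(e^2)^2-f_3^2(e^3)^2-f^2dt^2 .$$
   Context: Write $e^{ij}=e^i\wedge e^j$. Structure equations used for each type: - Type $IX$ ($SU(2)$): $de^1=-e^{23}$, $de^2=-e^{31}$, $de^3=-e^{12}$. - Type $VIII$ ($SU(1,1)$): $de^1=-e^{23}$, $de^2=-e^{31}$, $de^3=e^{12}$. - Type $II$ (Heisenberg group): $de^1=de^2=0$, $de^3=-e^{12}$. - Type $VII_0$ (rigid motions of the Euclidean 2-plane): $de^1=0$, $de^2=e^{13}$, $de^3=-e^{12}$. - Type $VI_0$ (rigid motions of the Lorentzian 2-plane): $de^1=0$, $de^2=e^{13}$, $de^3=e^{12}$. Given nowhere vanishing functions $f_1,f_2,f_3,f$ on $I$ (differentiable as needed), put $e^i(t)=f_i(t)e^i$, $i=1,2,3$. The diagonal almost hyper-parahermitian structure on $G\times I$ determined by $(f_1,f_2,f_3,f)$ is the one with neutral metric $g=(e^1(t))^2+(e^2(t))^2-(e^3(t))^2-f(t)^2dt^2$ and fundamental 2-forms $\Omega_1=g(\cdot,J\cdot)$, $\Omega_2=g(\cdot,P_1\cdot)$,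 $\Omega_3=g(\cdot,P_2\cdot)$ given by $\Omega_1=-e^1(t)\wedge e^2(t)+e^3(t)\wedge f(t)dt$, $\Omega_2=e^1(t)\wedge e^3(t)-e^2(t)\wedge f(t)dt$, $\Omega_3=e^2(t)\wedge e^3(t)+e^1(t)\wedge f(t)dt$; here $J^2=-P_1^2=-P_2^2=-\mathrm{Id}$, $JP_1=-P_1J=P_2$, and $g(J\cdot,J\cdot)=-g(P_1\cdot,P_1\cdot)=-g(P_2\cdot,P_2\cdot)=g(\cdot,\cdot)$. It is hyper-symplectic if $d\Omega_1=d\Omega_2=d\Omega_3=0$.
   Formalization: The general solution is taken up to signs: (f1,f2,f3,f) is given by the formulas after replacing it by (s1 f1, s2 f2, s3 f3, s1 s2 s3 f) with each si = ±1, since solutions with other signs exist; the interval I is taken open and nonempty. *)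

theory Defs
  imports "HOL-Analysis.Analysis" "HOL-Algebra.Group"
begin

section \<open>Smooth manifolds and Lie groups\<close>

text \<open>All sets on which smoothness is considered below are open.\<close>

primrec Ck_on :: "nat \<Rightarrow> ('a::real_normed_vector \<Rightarrow> 'b::real_normed_vector) \<Rightarrow> 'a set \<Rightarrow> bool" where
  "Ck_on 0 f S \<longleftrightarrow> continuous_on S f"
| "Ck_on (Suc k) f S \<longleftrightarrow>
     f differentiable_on S \<and> (\<forall>v. Ck_on k (\<lambda>x. frechet_derivative f (at x) v) S)"

definition smooth_on :: "('a::real_normed_vector \<Rightarrow> 'b::real_normed_vector) \<Rightarrow> 'a set \<Rightarrow> bool" where
  "smooth_on f S \<longleftrightarrow> (\<forall>k. Ck_on k f S)"

text \<open>A chart is a pair of a domain and a coordinate map.\<close>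

type_synonym ('p, 'm) chart = "'p set \<times> ('p \<Rightarrow> 'm)"

definition chart_image :: "('p, 'm) chart \<Rightarrow> 'm set" where
  "chart_image c = snd c ` fst c"

definition chart_inv :: "('p, 'm) chart \<Rightarrow> 'm \<Rightarrow> 'p" where
  "chart_inv c = inv_into (fst c) (snd c)"

locale smooth_manifold =
  fixes T :: "'p topology" and A :: "('p, 'm::euclidean_space) chart set"
  assumes hausdorff: "Hausdorff_space T"
    and countable_base: "second_countable T"
    and charts_cover: "(\<Union>c\<in>A. fst c) = topspace T"
    and chart_domain_open: "c \<in> A \<Longrightarrow> openin T (fst c)"
    and chart_image_open: "c \<in> A \<Longrightarrow> open (chart_image c)"
    and chart_homeomorphic:
      "c \<in> A \<Longrightarrow> homeomorphic_map (subtopology T (fst c)) (top_of_set (chart_image c)) (snd c)"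
    and transition_smooth:
      "c \<in> A \<Longrightarrow> c' \<in> A \<Longrightarrow> smooth_on (snd c' \<circ> chart_inv c) (snd c ` (fst c \<inter> fst c'))"

definition smooth_map ::
  "'p topology \<Rightarrow> ('p, 'm::euclidean_space) chart set \<Rightarrow>
   'q topology \<Rightarrow> ('q, 'n::euclidean_space) chart set \<Rightarrow> ('p \<Rightarrow> 'q) \<Rightarrow> bool" where
  "smooth_map T A T' A' F \<longleftrightarrow>
     continuous_map T T' F \<and>
     (\<forall>c\<in>A. \<forall>c'\<in>A'. smooth_on (snd c' \<circ> F \<circ> chart_inv c) (snd c ` (fst c \<inter> F -` fst c')))"

definition prod_atlas ::
  "('p, 'm) chart set \<Rightarrow> ('q, 'n) chart set \<Rightarrow> ('p \<times> 'q, 'm \<times> 'n) chart set" where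
  "prod_atlas A A' = {(fst c \<times> fst c', map_prod (snd c) (snd c')) | c c'. c \<in> A \<and> c' \<in> A'}"

locale lie_group = group G + smooth_manifold T A
  for G :: "('p, 'more) monoid_scheme" (structure)
    and T :: "'p topology" and A :: "('p, 'm::euclidean_space) chart set" +
  assumes topspace_carrier: "topspace T = carrier G"
    and mult_smooth: "smooth_map (prod_topology T T) (prod_atlas A A) T A (\<lambda>(x, y). x \<otimes> y)"
    and inv_smooth: "smooth_map T A T A (\<lambda>x. inv x)"


section \<open>Differential forms\<close>

text \<open>
  A tensor field on a manifold is given by its local representatives, one for each chart: the
  value at a chart \<open>c\<close> and a point \<open>x\<close> of its image is a multilinear map on the model space.
\<close>

type_synonym ('c, 'v) form1 = "'c \<Rightarrow> 'v \<Rightarrow> 'v \<Rightarrow> real"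
type_synonym ('c, 'v) form2 = "'c \<Rightarrow> 'v \<Rightarrow> 'v \<Rightarrow> 'v \<Rightarrow> real"

definition wedge :: "('v \<Rightarrow> real) \<Rightarrow> ('v \<Rightarrow> real) \<Rightarrow> 'v \<Rightarrow> 'v \<Rightarrow> real" where
  "wedge \<alpha> \<beta> u v = \<alpha> u * \<beta> v - \<alpha> v * \<beta> u"

definition ext_deriv1 ::
  "('v::real_normed_vector \<Rightarrow> 'v \<Rightarrow> real) \<Rightarrow> 'v \<Rightarrow> 'v \<Rightarrow> 'v \<Rightarrow> real" where
  "ext_deriv1 \<alpha> x u v =
     frechet_derivative (\<lambda>y. \<alpha> y v) (at x) u - frechet_derivative (\<lambda>y. \<alpha> y u) (at x) v"

definition ext_deriv2 ::
  "('v::real_normed_vector \<Rightarrow> 'v \<Rightarrow> 'v \<Rightarrow> real) \<Rightarrow> 'v \<Rightarrow> 'v \<Rightarrow> 'v \<Rightarrow> 'v \<Rightarrow> real" where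
  "ext_deriv2 \<omega> x u v w =
     frechet_derivative (\<lambda>y. \<omega> y v w) (at x) u
     - frechet_derivative (\<lambda>y. \<omega> y u w) (at x) v
     + frechet_derivative (\<lambda>y. \<omega> y u v) (at x) w"

definition smooth_form1 :: "('p, 'm::euclidean_space) chart set \<Rightarrow> (('p, 'm) chart, 'm) form1 \<Rightarrow> bool" where
  "smooth_form1 A \<alpha> \<longleftrightarrow>
     (\<forall>c\<in>A. \<forall>x\<in>chart_image c. linear (\<alpha> c x)) \<and>
     (\<forall>c\<in>A. \<forall>v. smooth_on (\<lambda>x. \<alpha> c x v) (chart_image c)) \<and>
     (\<forall>c\<in>A. \<forall>c'\<in>A. \<forall>p\<in>fst c \<inter> fst c'. \<forall>v.
        \<alpha> c' (snd c' p) (frechet_derivative (snd c' \<circ> chart_inv c) (at (snd c p)) v)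
        = \<alpha> c (snd c p) v)"

definition left_invariant_form1 ::
  "('p, 'more) monoid_scheme \<Rightarrow> ('p, 'm::euclidean_space) chart set \<Rightarrow>
   (('p, 'm) chart, 'm) form1 \<Rightarrow> bool" where
  "left_invariant_form1 G A \<alpha> \<longleftrightarrow>
     smooth_form1 A \<alpha> \<and>
     (\<forall>g\<in>carrier G. \<forall>c\<in>A. \<forall>c'\<in>A. \<forall>p\<in>fst c. g \<otimes>\<^bsub>G\<^esub> p \<in> fst c' \<longrightarrow>
        (\<forall>v. \<alpha> c' (snd c' (g \<otimes>\<^bsub>G\<^esub> p))
               (frechet_derivative (\<lambda>y. snd c' (g \<otimes>\<^bsub>G\<^esub> chart_inv c y)) (at (snd c p)) v)
             = \<alpha> c (snd c p) v))"

text \<open>A basis of the real vector space of left-invariant 1-forms.\<close>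

definition left_invariant_basis ::
  "('p, 'more) monoid_scheme \<Rightarrow> ('p, real^3) chart set \<Rightarrow>
   (('p, real^3) chart, real^3) form1 \<Rightarrow> (('p, real^3) chart, real^3) form1 \<Rightarrow>
   (('p, real^3) chart, real^3) form1 \<Rightarrow> bool" where
  "left_invariant_basis G A e1 e2 e3 \<longleftrightarrow>
     left_invariant_form1 G A e1 \<and> left_invariant_form1 G A e2 \<and> left_invariant_form1 G A e3 \<and>
     (\<forall>\<alpha>. left_invariant_form1 G A \<alpha> \<longrightarrow>
        (\<exists>!k::real^3. \<forall>c\<in>A. \<forall>x\<in>chart_image c. \<forall>v.
           \<alpha> c x v = k$1 * e1 c x v + k$2 * e2 c x v + k$3 * e3 c x v))"

definition d_eq :: "('p, 'm::euclidean_space) chart set \<Rightarrow>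
    (('p, 'm) chart, 'm) form1 \<Rightarrow> (('p, 'm) chart, 'm) form2 \<Rightarrow> bool" where
  "d_eq A \<alpha> \<omega> \<longleftrightarrow>
     (\<forall>c\<in>A. \<forall>x\<in>chart_image c. \<forall>u v. ext_deriv1 (\<alpha> c) x u v = \<omega> c x u v)"

datatype bianchi = Type_IX | Type_VIII | Type_II | Type_VII0 | Type_VI0

fun structure_equations ::
  "bianchi \<Rightarrow> ('p, 'm::euclidean_space) chart set \<Rightarrow>
   (('p, 'm) chart, 'm) form1 \<Rightarrow> (('p, 'm) chart, 'm) form1 \<Rightarrow> (('p, 'm) chart, 'm) form1 \<Rightarrow> bool" where
  "structure_equations Type_IX A e1 e2 e3 \<longleftrightarrow>
     d_eq A e1 (\<lambda>c x u v. - wedge (e2 c x) (e3 c x) u v) \<and>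
     d_eq A e2 (\<lambda>c x u v. - wedge (e3 c x) (e1 c x) u v) \<and>
     d_eq A e3 (\<lambda>c x u v. - wedge (e1 c x) (e2 c x) u v)"
| "structure_equations Type_VIII A e1 e2 e3 \<longleftrightarrow>
     d_eq A e1 (\<lambda>c x u v. - wedge (e2 c x) (e3 c x) u v) \<and>
     d_eq A e2 (\<lambda>c x u v. - wedge (e3 c x) (e1 c x) u v) \<and>
     d_eq A e3 (\<lambda>c x u v. wedge (e1 c x) (e2 c x) u v)"
| "structure_equations Type_II A e1 e2 e3 \<longleftrightarrow>
     d_eq A e1 (\<lambda>c x u v. 0) \<and>
     d_eq A e2 (\<lambda>c x u v. 0) \<and>
     d_eq A e3 (\<lambda>c x u v. - wedge (e1 c x) (e2 c x) u v)"
| "structure_equations Type_VII0 A e1 e2 e3 \<longleftrightarrow>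
     d_eq A e1 (\<lambda>c x u v. 0) \<and>
     d_eq A e2 (\<lambda>c x u v. wedge (e1 c x) (e3 c x) u v) \<and>
     d_eq A e3 (\<lambda>c x u v. - wedge (e1 c x) (e2 c x) u v)"
| "structure_equations Type_VI0 A e1 e2 e3 \<longleftrightarrow>
     d_eq A e1 (\<lambda>c x u v. 0) \<and>
     d_eq A e2 (\<lambda>c x u v. wedge (e1 c x) (e3 c x) u v) \<and>
     d_eq A e3 (\<lambda>c x u v. wedge (e1 c x) (e2 c x) u v)"


section \<open>Almost hyper-parahermitian structures on \<open>G \<times> I\<close>\<close>

text \<open>
  \<open>I\<close> is an open interval. A chart \<open>c\<close> of \<open>G\<close> induces the chart \<open>c \<times> id\<close> of \<open>G \<times> I\<close>, with image
  \<open>chart_image c \<times> I\<close>; these charts form an atlas, and tensor fields on \<open>G \<times> I\<close> are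
  represented in them, indexed by \<open>c\<close>.
\<close>

type_synonym ('c, 'v) endo = "'c \<Rightarrow> 'v \<Rightarrow> 'v \<Rightarrow> 'v"

record ('c, 'v) hph_structure =
  metric :: "('c, 'v) form2"
  cplx :: "('c, 'v) endo"
  para1 :: "('c, 'v) endo"
  para2 :: "('c, 'v) endo"

definition neutral_metric :: "('v::euclidean_space \<Rightarrow> 'v \<Rightarrow> real) \<Rightarrow> bool" where
  "neutral_metric g \<longleftrightarrow>
     bilinear g \<and> (\<forall>u v. g u v = g v u) \<and>
     (\<exists>V W. subspace V \<and> subspace W \<and> 2 * dim V = DIM('v) \<and> 2 * dim W = DIM('v) \<and>
        (\<forall>v\<in>V. v \<noteq> 0 \<longrightarrow> g v v > 0) \<and> (\<forall>w\<in>W. w \<noteq> 0 \<longrightarrow> g w w < 0))"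

definition hyper_parahermitian_at ::
  "('v::euclidean_space \<Rightarrow> 'v \<Rightarrow> real) \<Rightarrow> ('v \<Rightarrow> 'v) \<Rightarrow> ('v \<Rightarrow> 'v) \<Rightarrow> ('v \<Rightarrow> 'v) \<Rightarrow> bool" where
  "hyper_parahermitian_at g J P1 P2 \<longleftrightarrow>
     neutral_metric g \<and> linear J \<and> linear P1 \<and> linear P2 \<and>
     (\<forall>v. J (J v) = - v \<and> P1 (P1 v) = v \<and> P2 (P2 v) = v) \<and>
     (\<forall>v. J (P1 v) = P2 v \<and> P1 (J v) = - P2 v) \<and>
     (\<forall>u v. g (J u) (J v) = g u v \<and> g (P1 u) (P1 v) = - g u v \<and> g (P2 u) (P2 v) = - g u v)"

definition almost_hyper_parahermitian ::
  "('p, real^3) chart set \<Rightarrow> real set \<Rightarrow> (('p, real^3) chart, (real^3) \<times> real) hph_structure \<Rightarrow> bool" where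
  "almost_hyper_parahermitian A I S \<longleftrightarrow>
     (\<forall>c\<in>A. \<forall>z\<in>chart_image c \<times> I.
        hyper_parahermitian_at (metric S c z) (cplx S c z) (para1 S c z) (para2 S c z))"

definition fundamental_form :: "('c, 'v) form2 \<Rightarrow> ('c, 'v) endo \<Rightarrow> ('c, 'v) form2" where
  "fundamental_form g K = (\<lambda>c z u v. g c z u (K c z v))"

definition closed_form2 ::
  "('p, real^3) chart set \<Rightarrow> real set \<Rightarrow> (('p, real^3) chart, (real^3) \<times> real) form2 \<Rightarrow> bool" where
  "closed_form2 A I \<omega> \<longleftrightarrow>
     (\<forall>c\<in>A. \<forall>z\<in>chart_image c \<times> I. \<forall>u v w. ext_deriv2 (\<omega> c) z u v w = 0)"

definition hyper_symplectic ::
  "('p, real^3) chart set \<Rightarrow> real set \<Rightarrow> (('p, real^3) chart, (real^3) \<times> real) hph_structure \<Rightarrow> bool" where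
  "hyper_symplectic A I S \<longleftrightarrow>
     almost_hyper_parahermitian A I S \<and>
     closed_form2 A I (fundamental_form (metric S) (cplx S)) \<and>
     closed_form2 A I (fundamental_form (metric S) (para1 S)) \<and>
     closed_form2 A I (fundamental_form (metric S) (para2 S))"

text \<open>The 1-forms \<open>f\<^sub>i(t) e\<^sup>i\<close> and \<open>f(t) dt\<close> on \<open>G \<times> I\<close>.\<close>

definition scaled_form :: "(real \<Rightarrow> real) \<Rightarrow> ('c, 'm) form1 \<Rightarrow> ('c, 'm \<times> real) form1" where
  "scaled_form h e = (\<lambda>c z v. h (snd z) * e c (fst z) (fst v))"

definition scaled_dt :: "(real \<Rightarrow> real) \<Rightarrow> ('c, 'm \<times> real) form1" where
  "scaled_dt h = (\<lambda>c z v. h (snd z) * snd v)"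

definition diag_metric :: "('c, 'v) form1 \<Rightarrow> ('c, 'v) form1 \<Rightarrow> ('c, 'v) form1 \<Rightarrow> ('c, 'v) form1 \<Rightarrow>
    ('c, 'v) form2" where
  "diag_metric E1 E2 E3 E4 = (\<lambda>c z u v.
     E1 c z u * E1 c z v + E2 c z u * E2 c z v - E3 c z u * E3 c z v - E4 c z u * E4 c z v)"

definition diag_Omega1 :: "('c, 'v) form1 \<Rightarrow> ('c, 'v) form1 \<Rightarrow> ('c, 'v) form1 \<Rightarrow> ('c, 'v) form1 \<Rightarrow>
    ('c, 'v) form2" where
  "diag_Omega1 E1 E2 E3 E4 = (\<lambda>c z u v.
     - wedge (E1 c z) (E2 c z) u v + wedge (E3 c z) (E4 c z) u v)"

definition diag_Omega2 :: "('c, 'v) form1 \<Rightarrow> ('c, 'v) form1 \<Rightarrow> ('c, 'v) form1 \<Rightarrow> ('c, 'v) form1 \<Rightarrow>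
    ('c, 'v) form2" where
  "diag_Omega2 E1 E2 E3 E4 = (\<lambda>c z u v.
     wedge (E1 c z) (E3 c z) u v - wedge (E2 c z) (E4 c z) u v)"

definition diag_Omega3 :: "('c, 'v) form1 \<Rightarrow> ('c, 'v) form1 \<Rightarrow> ('c, 'v) form1 \<Rightarrow> ('c, 'v) form1 \<Rightarrow>
    ('c, 'v) form2" where
  "diag_Omega3 E1 E2 E3 E4 = (\<lambda>c z u v.
     wedge (E2 c z) (E3 c z) u v + wedge (E1 c z) (E4 c z) u v)"

text \<open>The endomorphism field \<open>K\<close> determined by \<open>g(u, K v) = \<omega>(u, v)\<close> for a nondegenerate \<open>g\<close>.\<close>

definition endo_of_form :: "('c, 'v) form2 \<Rightarrow> ('c, 'v) form2 \<Rightarrow> ('c, 'v) endo" where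
  "endo_of_form g \<omega> = (\<lambda>c z v. THE w. \<forall>u. g c z u w = \<omega> c z u v)"

definition hph_of_coframe ::
  "('c, 'v) form1 \<Rightarrow> ('c, 'v) form1 \<Rightarrow> ('c, 'v) form1 \<Rightarrow> ('c, 'v) form1 \<Rightarrow> ('c, 'v) hph_structure" where
  "hph_of_coframe E1 E2 E3 E4 =
     \<lparr> metric = diag_metric E1 E2 E3 E4,
       cplx = endo_of_form (diag_metric E1 E2 E3 E4) (diag_Omega1 E1 E2 E3 E4),
       para1 = endo_of_form (diag_metric E1 E2 E3 E4) (diag_Omega2 E1 E2 E3 E4),
       para2 = endo_of_form (diag_metric E1 E2 E3 E4) (diag_Omega3 E1 E2 E3 E4) \<rparr>"

definition diagonal_structure ::
  "('c, 'm) form1 \<Rightarrow> ('c, 'm) form1 \<Rightarrow> ('c, 'm) form1 \<Rightarrow>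
   (real \<Rightarrow> real) \<Rightarrow> (real \<Rightarrow> real) \<Rightarrow> (real \<Rightarrow> real) \<Rightarrow> (real \<Rightarrow> real) \<Rightarrow>
   ('c, 'm \<times> real) hph_structure" where
  "diagonal_structure e1 e2 e3 f1 f2 f3 f =
     hph_of_coframe (scaled_form f1 e1) (scaled_form f2 e2) (scaled_form f3 e3) (scaled_dt f)"


section \<open>The systems of ODEs and their explicit solutions\<close>

fun ode_system :: "bianchi \<Rightarrow> real set \<Rightarrow>
    (real \<Rightarrow> real) \<Rightarrow> (real \<Rightarrow> real) \<Rightarrow> (real \<Rightarrow> real) \<Rightarrow> (real \<Rightarrow> real) \<Rightarrow> bool" where
  "ode_system Type_IX I f1 f2 f3 f \<longleftrightarrow> (\<forall>t\<in>I.
     ((\<lambda>s. f1 s * f2 s) has_real_derivative - (f t * f3 t)) (at t) \<and>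
     ((\<lambda>s. f1 s * f3 s) has_real_derivative f t * f2 t) (at t) \<and>
     ((\<lambda>s. f2 s * f3 s) has_real_derivative f t * f1 t) (at t))"
| "ode_system Type_VIII I f1 f2 f3 f \<longleftrightarrow> (\<forall>t\<in>I.
     ((\<lambda>s. f1 s * f2 s) has_real_derivative f t * f3 t) (at t) \<and>
     ((\<lambda>s. f1 s * f3 s) has_real_derivative f t * f2 t) (at t) \<and>
     ((\<lambda>s. f2 s * f3 s) has_real_derivative f t * f1 t) (at t))"
| "ode_system Type_II I f1 f2 f3 f \<longleftrightarrow> (\<forall>t\<in>I.
     ((\<lambda>s. f1 s * f2 s) has_real_derivative - (f t * f3 t)) (at t) \<and>
     ((\<lambda>s. f1 s * f3 s) has_real_derivative 0) (at t) \<and>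
     ((\<lambda>s. f2 s * f3 s) has_real_derivative 0) (at t))"
| "ode_system Type_VII0 I f1 f2 f3 f \<longleftrightarrow> (\<forall>t\<in>I.
     ((\<lambda>s. f1 s * f2 s) has_real_derivative - (f t * f3 t)) (at t) \<and>
     ((\<lambda>s. f1 s * f3 s) has_real_derivative f t * f2 t) (at t) \<and>
     ((\<lambda>s. f2 s * f3 s) has_real_derivative 0) (at t))"
| "ode_system Type_VI0 I f1 f2 f3 f \<longleftrightarrow> (\<forall>t\<in>I.
     ((\<lambda>s. f1 s * f2 s) has_real_derivative f t * f3 t) (at t) \<and>
     ((\<lambda>s. f1 s * f3 s) has_real_derivative f t * f2 t) (at t) \<and>
     ((\<lambda>s. f2 s * f3 s) has_real_derivative 0) (at t))"

fun explicit_solution :: "bianchi \<Rightarrow> real set \<Rightarrow>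
    (real \<Rightarrow> real) \<Rightarrow> (real \<Rightarrow> real) \<Rightarrow> (real \<Rightarrow> real) \<Rightarrow> (real \<Rightarrow> real) \<Rightarrow> bool" where
  "explicit_solution Type_IX I f1 f2 f3 f \<longleftrightarrow> (\<exists>a1 a2 a3 x x'. \<forall>t\<in>I.
     (x has_real_derivative x' t) (at t) \<and> x t - a1 > 0 \<and> x t - a2 > 0 \<and> a3 - x t > 0 \<and>
     f1 t = (x t - a2) powr (1/4) * (a3 - x t) powr (1/4) / (x t - a1) powr (1/4) \<and>
     f2 t = (x t - a1) powr (1/4) * (a3 - x t) powr (1/4) / (x t - a2) powr (1/4) \<and>
     f3 t = (x t - a1) powr (1/4) * (x t - a2) powr (1/4) / (a3 - x t) powr (1/4) \<and>
     f t = 1/2 * ((x t - a1) * (x t - a2) * (a3 - x t)) powr (-1/4) * x' t)"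
| "explicit_solution Type_VIII I f1 f2 f3 f \<longleftrightarrow> (\<exists>a1 a2 a3 x x'. \<forall>t\<in>I.
     (x has_real_derivative x' t) (at t) \<and> x t - a1 > 0 \<and> x t - a2 > 0 \<and> x t - a3 > 0 \<and>
     f1 t = (x t - a2) powr (1/4) * (x t - a3) powr (1/4) / (x t - a1) powr (1/4) \<and>
     f2 t = (x t - a3) powr (1/4) * (x t - a1) powr (1/4) / (x t - a2) powr (1/4) \<and>
     f3 t = (x t - a1) powr (1/4) * (x t - a2) powr (1/4) / (x t - a3) powr (1/4) \<and>
     f t = 1/2 * ((x t - a1) * (x t - a2) * (x t - a3)) powr (-1/4) * x' t)"
| "explicit_solution Type_II I f1 f2 f3 f \<longleftrightarrow> (\<exists>a b c r u. a > 0 \<and> b > 0 \<and> (\<forall>t\<in>I.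
     u t = 3/2 * (a * b) powr (1/4) * r t + c \<and> u t > 0 \<and>
     f1 t = (b / a) powr (1/4) * u t powr (1/3) \<and>
     f2 t = (a / b) powr (1/4) * u t powr (1/3) \<and>
     f3 t = - ((a * b) powr (1/4)) * u t powr (-1/3) \<and>
     (r has_real_derivative f t) (at t)))"
| "explicit_solution Type_VII0 I f1 f2 f3 f \<longleftrightarrow> (\<exists>a1 a2 a3 x x'. a1 > 0 \<and> (\<forall>t\<in>I.
     (x has_real_derivative x' t) (at t) \<and> x t - a2 > 0 \<and> a3 - x t > 0 \<and>
     f1 t = (x t - a2) powr (1/4) * (a3 - x t) powr (1/4) / a1 powr (1/4) \<and>
     f2 t = a1 powr (1/4) * (a3 - x t) powr (1/4) / (x t - a2) powr (1/4) \<and>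
     f3 t = a1 powr (1/4) * (x t - a2) powr (1/4) / (a3 - x t) powr (1/4) \<and>
     f t = 1/2 * (a1 * (x t - a2) * (a3 - x t)) powr (-1/4) * x' t))"
| "explicit_solution Type_VI0 I f1 f2 f3 f \<longleftrightarrow> (\<exists>a1 a2 a3 x x'. a1 > 0 \<and> (\<forall>t\<in>I.
     (x has_real_derivative x' t) (at t) \<and> x t - a2 > 0 \<and> x t - a3 > 0 \<and>
     f1 t = (x t - a2) powr (1/4) * (x t - a3) powr (1/4) / a1 powr (1/4) \<and>
     f2 t = a1 powr (1/4) * (x t - a3) powr (1/4) / (x t - a2) powr (1/4) \<and>
     f3 t = a1 powr (1/4) * (x t - a2) powr (1/4) / (x t - a3) powr (1/4) \<and>
     f t = 1/2 * (a1 * (x t - a2) * (x t - a3)) powr (-1/4) * x' t))"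

text \<open>
  The explicit formulas fix the signs of \<open>f1\<close>, \<open>f2\<close>, \<open>f3\<close>, whereas each of the systems above is
  invariant under \<open>(f1, f2, f3, f) \<mapsto> (s1 f1, s2 f2, s3 f3, s1 s2 s3 f)\<close> for signs \<open>s1, s2, s3\<close>
  (the metric is unchanged). The general solution is therefore understood up to these signs.
\<close>

definition general_solution :: "bianchi \<Rightarrow> real set \<Rightarrow>
    (real \<Rightarrow> real) \<Rightarrow> (real \<Rightarrow> real) \<Rightarrow> (real \<Rightarrow> real) \<Rightarrow> (real \<Rightarrow> real) \<Rightarrow> bool" where
  "general_solution B I f1 f2 f3 f \<longleftrightarrow>
     (\<exists>s1\<in>{-1, 1}. \<exists>s2\<in>{-1, 1}. \<exists>s3\<in>{-1, 1}.
        explicit_solution B I (\<lambda>t. s1 * f1 t) (\<lambda>t. s2 * f2 t) (\<lambda>t. s3 * f3 t)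
          (\<lambda>t. s1 * s2 * s3 * f t))"

end

theory Submission
  imports Defs
begin

text \<open>
  The statement splits into pointwise algebra, one exterior derivative and the integration of an
  ODE system.

  Algebra. A linear relation between \<open>e1\<close>, \<open>e2\<close>, \<open>e3\<close> at one point spreads over the whole group by
  left translation, so a basis of the left-invariant 1-forms is a coframe at every point
  (\<open>left_invariant_basis_independent\<close>). Hence \<open>f1 e1\<close>, \<open>f2 e2\<close>, \<open>f3 e3\<close>, \<open>f dt\<close> is a coframe of
  \<open>G \<times> I\<close>, in which the metric is \<open>diag(1, 1, -1, -1)\<close> and \<open>J\<close>, \<open>P1\<close>, \<open>P2\<close> merely permute the
  coordinates up to sign; this gives the almost hyper-parahermitian structure
  (\<open>hph_of_coframe_at\<close>).

  Closedness. In all five types the structure equations read \<open>de1 = k1 e23\<close>, \<open>de2 = k2 e13\<close>,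
  \<open>de3 = k3 e12\<close> with \<open>k1\<close>, \<open>k2\<close>, \<open>k3\<close> in \<open>{-1, 0, 1}\<close>. Each fundamental form is
  \<open>F(t) \<alpha> \<and> \<beta> + H(t) \<gamma> \<and> dt\<close> with \<open>{\<alpha>, \<beta>, \<gamma>} = {e1, e2, e3}\<close>. As \<open>d(\<alpha> \<and> \<beta>) = 0\<close> and
  \<open>d\<gamma> = k \<alpha> \<and> \<beta>\<close>, its differential is \<open>(F' + k H) \<alpha> \<and> \<beta> \<and> dt\<close> (\<open>ext_deriv2_mixed\<close>), so it is
  closed exactly when \<open>F' = - k H\<close>. The three equations obtained are the ODE system.

  Integration. The system says that \<open>(f1 f2)\<^sup>2\<close>, \<open>(f1 f3)\<^sup>2\<close>, \<open>(f2 f3)\<^sup>2\<close> have derivatives \<open>k3 x'\<close>,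
  \<open>k2 x'\<close>, \<open>- k1 x'\<close> with the common factor \<open>x' = 2 f f1 f2 f3\<close>. For positive \<open>f1\<close>, \<open>f2\<close>, \<open>f3\<close> it is
  therefore equivalent to these three squares being affine functions of a primitive \<open>x\<close>
  (\<open>ode_system_iff_first_integrals\<close>), and solving for \<open>f1\<close>, \<open>f2\<close>, \<open>f3\<close> gives the fourth roots of
  the explicit solution (\<open>quartic_roots_iff\<close>). In type \<open>II\<close> two of the products \<open>fi fj\<close> are
  constant and the remaining equation is integrated with \<open>u = (f1 f2) powr (3/2)\<close> as parameter.
  Since \<open>f1\<close>, \<open>f2\<close>, \<open>f3\<close> have constant sign on an interval, the sign symmetry of the system reduces
  the general case to the signs in the explicit formulas.
\<close>

section \<open>Left-invariant coframes\<close>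

lemma Ck_on_zero: "Ck_on k (\<lambda>x. 0) S"
  by (induction k) (auto simp: frechet_derivative_const)

lemma left_invariant_form1_zero: "left_invariant_form1 G A (\<lambda>c x v. 0)"
  by (auto simp: left_invariant_form1_def smooth_form1_def smooth_on_def Ck_on_zero linear_zero)

text \<open>
  A relation at the point \<open>p\<close> is carried to an arbitrary point \<open>q\<close> by the translation by
  \<open>p * inv q\<close>, which maps \<open>q\<close> to \<open>p\<close>: a left-invariant form at \<open>q\<close> is the pullback of its value at \<open>p\<close>.
  The combination then vanishes identically, and uniqueness of the coefficients of the zero form
  finishes the proof.
\<close>
lemma left_invariant_basis_independent:
  fixes A :: "('p, real^3) chart set" and k :: "real^3"
  assumes "lie_group G T A" and basis: "left_invariant_basis G A e1 e2 e3"
    and "c \<in> A" "x \<in> chart_image c"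
    and vanish: "\<And>v. k$1 * e1 c x v + k$2 * e2 c x v + k$3 * e3 c x v = 0"
  shows "k = 0"
proof -
  interpret lie_group G T A by fact
  obtain p where p: "p \<in> fst c" "x = snd c p"
    using \<open>x \<in> chart_image c\<close> by (auto simp: chart_image_def)
  have carr: "q \<in> carrier G" if "c' \<in> A" "q \<in> fst c'" for q c'
    using that charts_cover topspace_carrier by blast
  note inv = basis[unfolded left_invariant_basis_def left_invariant_form1_def]
  have everywhere: "k$1 * e1 c' y v + k$2 * e2 c' y v + k$3 * e3 c' y v = 0"
    if c': "c' \<in> A" and y: "y \<in> chart_image c'" for c' y v
  proof -
    obtain q where q: "q \<in> fst c'" "y = snd c' q"
      using y by (auto simp: chart_image_def)
    define g where "g = p \<otimes>\<^bsub>G\<^esub> inv\<^bsub>G\<^esub> q"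
    have pq: "p \<in> carrier G" "q \<in> carrier G" using carr p q \<open>c \<in> A\<close> c' by auto
    have g: "g \<in> carrier G" and gq: "g \<otimes>\<^bsub>G\<^esub> q = p"
      using pq by (auto simp: g_def m_assoc)
    define D where "D = frechet_derivative (\<lambda>z. snd c (g \<otimes>\<^bsub>G\<^esub> chart_inv c' z)) (at y)"
    have e: "e1 c x (D v) = e1 c' y v" "e2 c x (D v) = e2 c' y v" "e3 c x (D v) = e3 c' y v"
      using inv g gq p q \<open>c \<in> A\<close> c' unfolding D_def by metis+
    show ?thesis using vanish[of "D v"] by (simp add: e)
  qed
  have "\<exists>!k::real^3. \<forall>c\<in>A. \<forall>x\<in>chart_image c. \<forall>v.
      0 = k$1 * e1 c x v + k$2 * e2 c x v + k$3 * e3 c x v"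
    using basis left_invariant_form1_zero[of G A] unfolding left_invariant_basis_def by fast
  moreover have "\<forall>c\<in>A. \<forall>x\<in>chart_image c. \<forall>v.
      0 = k$1 * e1 c x v + k$2 * e2 c x v + k$3 * e3 c x v"
    by (simp add: everywhere)
  moreover have "\<forall>c\<in>A. \<forall>x\<in>chart_image c. \<forall>v.
      0 = (0::real^3)$1 * e1 c x v + (0::real^3)$2 * e2 c x v + (0::real^3)$3 * e3 c x v"
    by simp
  ultimately show "k = 0" by blast
qed

text \<open>
  If the joint evaluation map of the three functionals were not onto, a normal vector \<open>k\<close> of a
  hyperplane containing its range would be a relation between them.
\<close>
lemma independent_functionals_coordinates:
  fixes a1 a2 a3 :: "real^3 \<Rightarrow> real"
  assumes lin: "linear a1" "linear a2" "linear a3"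
    and indep: "\<And>k::real^3. (\<And>v. k$1 * a1 v + k$2 * a2 v + k$3 * a3 v = 0) \<Longrightarrow> k = 0"
  shows "\<exists>!v. a1 v = r1 \<and> a2 v = r2 \<and> a3 v = r3"
proof -
  define L :: "real^3 \<Rightarrow> real^3" where "L v = vector [a1 v, a2 v, a3 v]" for v
  have L: "L v $ 1 = a1 v" "L v $ 2 = a2 v" "L v $ 3 = a3 v" for v
    by (simp_all add: L_def)
  have linL: "linear L"
    by (rule linearI) (simp_all add: vec_eq_iff forall_3 L linear_add[OF lin(1)] linear_add[OF lin(2)]
        linear_add[OF lin(3)] linear_cmul[OF lin(1)] linear_cmul[OF lin(2)] linear_cmul[OF lin(3)])
  have "surj L"
  proof (rule ccontr)
    assume "\<not> surj L"
    then have "span (range L) \<noteq> UNIV"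
      using linL by (simp add: span_eq_iff[THEN iffD2] linear_subspace_image)
    then obtain k where k: "k \<noteq> 0" "span (range L) \<subseteq> {z. k \<bullet> z = 0}"
      using span_not_univ_subset_hyperplane by blast
    have "k \<bullet> L v = 0" for v
      using k(2) span_superset[of "range L"] by blast
    then have "k = 0"
      by (intro indep) (simp add: inner_vec_def sum_3 L)
    with k show False by simp
  qed
  moreover have "inj L"
    using linear_surjective_imp_injective[OF linL \<open>surj L\<close>] by simp
  ultimately have "\<exists>!v. L v = vector [r1, r2, r3]"
    by (metis injD surjD)
  then show ?thesis by (simp add: vec_eq_iff forall_3 L)
qed

section \<open>Hyper-parahermitian algebra in a coframe\<close>
locale coframe4 =
  fixes E1 E2 E3 E4 :: "'v::euclidean_space \<Rightarrow> real"
  assumes lin: "linear E1" "linear E2" "linear E3" "linear E4"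
    and coords: "\<exists>!v. E1 v = r1 \<and> E2 v = r2 \<and> E3 v = r3 \<and> E4 v = r4"
    and dim4: "DIM('v) = 4"
begin

lemma eqI: "E1 v = E1 w \<Longrightarrow> E2 v = E2 w \<Longrightarrow> E3 v = E3 w \<Longrightarrow> E4 v = E4 w \<Longrightarrow> v = w"
  using coords[of "E1 w" "E2 w" "E3 w" "E4 w"] by blast

lemmas E_simps =
  linear_add[OF lin(1)] linear_add[OF lin(2)] linear_add[OF lin(3)] linear_add[OF lin(4)]
  linear_cmul[OF lin(1)] linear_cmul[OF lin(2)] linear_cmul[OF lin(3)] linear_cmul[OF lin(4)]
  linear_neg[OF lin(1)] linear_neg[OF lin(2)] linear_neg[OF lin(3)] linear_neg[OF lin(4)]
  linear_0[OF lin(1)] linear_0[OF lin(2)] linear_0[OF lin(3)] linear_0[OF lin(4)]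

definition g :: "'v \<Rightarrow> 'v \<Rightarrow> real" where
  "g u v = E1 u * E1 v + E2 u * E2 v - E3 u * E3 v - E4 u * E4 v"

text \<open>
  Nondegeneracy of \<open>g\<close>: evaluating at the dual frame recovers the coordinates of \<open>w\<close>. This makes the
  definite description in \<^const>\<open>endo_of_form\<close> well-defined.
\<close>
lemma represent:
  assumes "\<And>u. \<omega> u = E1 u * r1 + E2 u * r2 - E3 u * r3 - E4 u * r4"
  defines "w \<equiv> (THE w. \<forall>u. g u w = \<omega> u)"
  shows "E1 w = r1 \<and> E2 w = r2 \<and> E3 w = r3 \<and> E4 w = r4"
proof -
  have iff: "(\<forall>u. g u w = \<omega> u) \<longleftrightarrow> E1 w = r1 \<and> E2 w = r2 \<and> E3 w = r3 \<and> E4 w = r4" for w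
  proof
    assume *: "\<forall>u. g u w = \<omega> u"
    obtain u1 where u1: "E1 u1 = 1" "E2 u1 = 0" "E3 u1 = 0" "E4 u1 = 0" using coords[of 1 0 0 0] by blast
    obtain u2 where u2: "E1 u2 = 0" "E2 u2 = 1" "E3 u2 = 0" "E4 u2 = 0" using coords[of 0 1 0 0] by blast
    obtain u3 where u3: "E1 u3 = 0" "E2 u3 = 0" "E3 u3 = 1" "E4 u3 = 0" using coords[of 0 0 1 0] by blast
    obtain u4 where u4: "E1 u4 = 0" "E2 u4 = 0" "E3 u4 = 0" "E4 u4 = 1" using coords[of 0 0 0 1] by blast
    show "E1 w = r1 \<and> E2 w = r2 \<and> E3 w = r3 \<and> E4 w = r4"
      using *[rule_format, of u1] *[rule_format, of u2] *[rule_format, of u3] *[rule_format, of u4]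
      by (simp add: assms(1) g_def u1 u2 u3 u4)
  qed (simp add: assms(1) g_def)
  show ?thesis unfolding w_def iff using theI'[OF coords[of r1 r2 r3 r4]] .
qed

lemma neutral: "neutral_metric g"
  unfolding neutral_metric_def
proof (intro conjI)
  show "bilinear g"
    unfolding bilinear_def g_def
    by (auto intro!: linearI simp: E_simps algebra_simps)
  show "\<forall>u v. g u v = g v u" by (simp add: g_def mult.commute)
  obtain u1 where u1: "E1 u1 = 1" "E2 u1 = 0" "E3 u1 = 0" "E4 u1 = 0" using coords[of 1 0 0 0] by blast
  obtain u2 where u2: "E1 u2 = 0" "E2 u2 = 1" "E3 u2 = 0" "E4 u2 = 0" using coords[of 0 1 0 0] by blast
  obtain u3 where u3: "E1 u3 = 0" "E2 u3 = 0" "E3 u3 = 1" "E4 u3 = 0" using coords[of 0 0 1 0] by blast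
  obtain u4 where u4: "E1 u4 = 0" "E2 u4 = 0" "E3 u4 = 0" "E4 u4 = 1" using coords[of 0 0 0 1] by blast
  have in_span: "z \<in> span {p, q} \<Longrightarrow> \<exists>r s. z = r *\<^sub>R p + s *\<^sub>R q" for z p q :: 'v
    by (auto simp: span_insert span_singleton algebra_simps)
  have "u1 \<noteq> u2" "u3 \<noteq> u4" using u1 u2 u3 u4 by force+
  have "independent {u1, u2}"
    using u1 u2 by (auto simp: independent_insert span_singleton E_simps)
  then have d12: "dim (span {u1, u2}) = 2" using \<open>u1 \<noteq> u2\<close> by (simp add: dim_eq_card_independent)
  have "independent {u3, u4}"
    using u3 u4 by (auto simp: independent_insert span_singleton E_simps)
  then have d34: "dim (span {u3, u4}) = 2" using \<open>u3 \<noteq> u4\<close> by (simp add: dim_eq_card_independent)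
  have pos: "g v v > 0" if in_V: "v \<in> span {u1, u2}" "v \<noteq> 0" for v
  proof -
    obtain r s where v: "v = r *\<^sub>R u1 + s *\<^sub>R u2" using in_span[OF in_V(1)] by blast
    then have "g v v = r\<^sup>2 + s\<^sup>2" by (simp add: g_def E_simps u1 u2 power2_eq_square)
    moreover have "r \<noteq> 0 \<or> s \<noteq> 0" using v in_V by auto
    ultimately show ?thesis by (simp add: sum_power2_gt_zero_iff)
  qed
  have neg: "g v v < 0" if in_V: "v \<in> span {u3, u4}" "v \<noteq> 0" for v
  proof -
    obtain r s where v: "v = r *\<^sub>R u3 + s *\<^sub>R u4" using in_span[OF in_V(1)] by blast
    then have "g v v = - (r\<^sup>2 + s\<^sup>2)" by (simp add: g_def E_simps u3 u4 power2_eq_square)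
    moreover have "r \<noteq> 0 \<or> s \<noteq> 0" using v in_V by auto
    ultimately show ?thesis using sum_power2_gt_zero_iff[of r s] by linarith
  qed
  show "\<exists>V W. subspace V \<and> subspace W \<and> 2 * dim V = DIM('v) \<and> 2 * dim W = DIM('v) \<and>
      (\<forall>v\<in>V. v \<noteq> 0 \<longrightarrow> g v v > 0) \<and> (\<forall>w\<in>W. w \<noteq> 0 \<longrightarrow> g w w < 0)"
    by (rule exI[of _ "span {u1, u2}"], rule exI[of _ "span {u3, u4}"])
      (use d12 d34 pos neg dim4 in \<open>simp del: dim_span\<close>)
qed

lemma hyper_parahermitian:
  assumes "\<And>v. E1 (J v) = - E2 v \<and> E2 (J v) = E1 v \<and> E3 (J v) = - E4 v \<and> E4 (J v) = E3 v"
    and "\<And>v. E1 (P v) = E3 v \<and> E2 (P v) = - E4 v \<and> E3 (P v) = E1 v \<and> E4 (P v) = - E2 v"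
    and "\<And>v. E1 (Q v) = E4 v \<and> E2 (Q v) = E3 v \<and> E3 (Q v) = E2 v \<and> E4 (Q v) = E1 v"
  shows "hyper_parahermitian_at g J P Q"
  unfolding hyper_parahermitian_at_def
  by (intro conjI allI linearI neutral eqI) (simp_all add: assms E_simps g_def)

end

section \<open>The exterior derivative of the fundamental forms\<close>
lemma has_derivative_scaled:
  fixes \<phi> :: "'m::euclidean_space \<Rightarrow> real"
  assumes "(h has_real_derivative h') (at t)" "\<phi> differentiable (at x)"
  shows "((\<lambda>z. h (snd z) * \<phi> (fst z)) has_derivative
      (\<lambda>u. h t * frechet_derivative \<phi> (at x) (fst u) + h' * snd u * \<phi> x)) (at (x, t))"
proof -
  have "((\<lambda>z. h (snd z)) has_derivative (\<lambda>u. h' * snd u)) (at (x, t))"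
    using assms(1) by (auto intro!: has_derivative_compose[OF has_derivative_snd[OF has_derivative_ident]]
        simp: has_field_derivative_def)
  moreover have "((\<lambda>z. \<phi> (fst z)) has_derivative (\<lambda>u. frechet_derivative \<phi> (at x) (fst u))) (at (x, t))"
    using assms(2) by (auto intro!: has_derivative_compose[OF has_derivative_fst[OF has_derivative_ident]]
        simp: frechet_derivative_works[symmetric])
  ultimately show ?thesis by (auto dest: has_derivative_mult)
qed

text \<open>
  The computation \<open>d(F \<alpha> \<and> \<beta> + H \<gamma> \<and> dt) = (F' + k\<^sub>\<gamma> H) \<alpha> \<and> \<beta> \<and> dt\<close>: the terms \<open>d\<alpha> \<and> \<beta>\<close> and
  \<open>\<alpha> \<and> d\<beta>\<close> contain a repeated factor, and \<open>H'\<close> only occurs with \<open>dt \<and> dt\<close>.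
\<close>
lemma ext_deriv2_mixed:
  fixes \<omega> :: "('m::euclidean_space \<times> real) \<Rightarrow> ('m \<times> real) \<Rightarrow> ('m \<times> real) \<Rightarrow> real"
    and \<alpha> \<beta> \<gamma> :: "'m \<Rightarrow> 'm \<Rightarrow> real"
  assumes U: "open U" "(x, t) \<in> U"
    and \<omega>: "\<And>z u v. z \<in> U \<Longrightarrow> \<omega> z u v =
      F (snd z) * wedge (\<alpha> (fst z)) (\<beta> (fst z)) (fst u) (fst v)
      + H (snd z) * (\<gamma> (fst z) (fst u) * snd v - \<gamma> (fst z) (fst v) * snd u)"
    and diff: "\<And>v. (\<lambda>y. \<alpha> y v) differentiable (at x)" "\<And>v. (\<lambda>y. \<beta> y v) differentiable (at x)"
      "\<And>v. (\<lambda>y. \<gamma> y v) differentiable (at x)"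
    and F: "(F has_real_derivative F') (at t)" and H: "(H has_real_derivative H') (at t)"
    and d\<alpha>: "\<And>u v. ext_deriv1 \<alpha> x u v = k\<^sub>\<alpha> * wedge (\<beta> x) (\<gamma> x) u v"
    and d\<beta>: "\<And>u v. ext_deriv1 \<beta> x u v = k\<^sub>\<beta> * wedge (\<alpha> x) (\<gamma> x) u v"
    and d\<gamma>: "\<And>u v. ext_deriv1 \<gamma> x u v = k\<^sub>\<gamma> * wedge (\<alpha> x) (\<beta> x) u v"
  shows "ext_deriv2 \<omega> (x, t) u v w = (F' + k\<^sub>\<gamma> * H t) *
    (wedge (\<alpha> x) (\<beta> x) (fst u) (fst v) * snd w - wedge (\<alpha> x) (\<beta> x) (fst u) (fst w) * snd v
     + wedge (\<alpha> x) (\<beta> x) (fst v) (fst w) * snd u)"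
proof -
  define D where "D \<phi> = frechet_derivative \<phi> (at x)" for \<phi> :: "'m \<Rightarrow> real"
  have fd: "frechet_derivative (\<lambda>z. \<omega> z a b) (at (x, t)) d =
      F' * snd d * wedge (\<alpha> x) (\<beta> x) (fst a) (fst b)
      + F t * (D (\<lambda>y. \<alpha> y (fst a)) (fst d) * \<beta> x (fst b) + \<alpha> x (fst a) * D (\<lambda>y. \<beta> y (fst b)) (fst d)
             - D (\<lambda>y. \<alpha> y (fst b)) (fst d) * \<beta> x (fst a) - \<alpha> x (fst b) * D (\<lambda>y. \<beta> y (fst a)) (fst d))
      + H' * snd d * (\<gamma> x (fst a) * snd b - \<gamma> x (fst b) * snd a)
      + H t * (D (\<lambda>y. \<gamma> y (fst a)) (fst d) * snd b - D (\<lambda>y. \<gamma> y (fst b)) (fst d) * snd a)"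
    for a b d
  proof -
    note der = has_derivative_scaled
    have w: "(\<lambda>y. wedge (\<alpha> y) (\<beta> y) (fst a) (fst b)) differentiable (at x)"
      unfolding wedge_def using diff by (auto intro!: derivative_intros)
    note works = diff[THEN frechet_derivative_works[THEN iffD1]]
    have wd: "((\<lambda>y. wedge (\<alpha> y) (\<beta> y) (fst a) (fst b)) has_derivative (\<lambda>p.
        (\<alpha> x (fst a) * D (\<lambda>y. \<beta> y (fst b)) p + D (\<lambda>y. \<alpha> y (fst a)) p * \<beta> x (fst b))
        - (\<alpha> x (fst b) * D (\<lambda>y. \<beta> y (fst a)) p + D (\<lambda>y. \<alpha> y (fst b)) p * \<beta> x (fst a)))) (at x)"
      unfolding D_def wedge_def by (intro has_derivative_diff has_derivative_mult works)
    have Dw: "D (\<lambda>y. wedge (\<alpha> y) (\<beta> y) (fst a) (fst b)) p =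
        D (\<lambda>y. \<alpha> y (fst a)) p * \<beta> x (fst b) + \<alpha> x (fst a) * D (\<lambda>y. \<beta> y (fst b)) p
        - D (\<lambda>y. \<alpha> y (fst b)) p * \<beta> x (fst a) - \<alpha> x (fst b) * D (\<lambda>y. \<beta> y (fst a)) p" for p
      using fun_cong[OF frechet_derivative_at[OF wd], of p] by (simp add: D_def)
    have "((\<lambda>z. F (snd z) * wedge (\<alpha> (fst z)) (\<beta> (fst z)) (fst a) (fst b)
          + (H (snd z) * \<gamma> (fst z) (fst a) * snd b - H (snd z) * \<gamma> (fst z) (fst b) * snd a)) has_derivative
        (\<lambda>d. (F t * D (\<lambda>y. wedge (\<alpha> y) (\<beta> y) (fst a) (fst b)) (fst d)
              + F' * snd d * wedge (\<alpha> x) (\<beta> x) (fst a) (fst b))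
          + ((H t * D (\<lambda>y. \<gamma> y (fst a)) (fst d) + H' * snd d * \<gamma> x (fst a)) * snd b
            - (H t * D (\<lambda>y. \<gamma> y (fst b)) (fst d) + H' * snd d * \<gamma> x (fst b)) * snd a))) (at (x, t))"
      unfolding D_def
      by (intro has_derivative_add has_derivative_diff has_derivative_mult_left
          der[OF F w] der[OF H diff(3)])
    then have "((\<lambda>z. \<omega> z a b) has_derivative
        (\<lambda>d. (F t * D (\<lambda>y. wedge (\<alpha> y) (\<beta> y) (fst a) (fst b)) (fst d)
              + F' * snd d * wedge (\<alpha> x) (\<beta> x) (fst a) (fst b))
          + ((H t * D (\<lambda>y. \<gamma> y (fst a)) (fst d) + H' * snd d * \<gamma> x (fst a)) * snd b
            - (H t * D (\<lambda>y. \<gamma> y (fst b)) (fst d) + H' * snd d * \<gamma> x (fst b)) * snd a))) (at (x, t))"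
      by (rule has_derivative_transform_within_open[OF _ U]) (simp add: \<omega> algebra_simps)
    from fun_cong[OF frechet_derivative_at[OF this], of d] show ?thesis
      by (simp add: Dw algebra_simps)
  qed
  \<comment> \<open>The structure equations exchange direction and argument in the derivatives of the 1-forms.
    Bringing all of them into one order leaves a polynomial identity.\<close>
  have cyc: "D (\<lambda>y. \<alpha> y q) p = D (\<lambda>y. \<alpha> y p) q + k\<^sub>\<alpha> * wedge (\<beta> x) (\<gamma> x) p q"
    "D (\<lambda>y. \<beta> y q) p = D (\<lambda>y. \<beta> y p) q + k\<^sub>\<beta> * wedge (\<alpha> x) (\<gamma> x) p q"
    "D (\<lambda>y. \<gamma> y q) p = D (\<lambda>y. \<gamma> y p) q + k\<^sub>\<gamma> * wedge (\<alpha> x) (\<beta> x) p q" for p q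
    using d\<alpha>[of p q] d\<beta>[of p q] d\<gamma>[of p q] by (simp_all add: ext_deriv1_def D_def)
  show ?thesis
    unfolding ext_deriv2_def fd
      cyc(1)[of "fst v" "fst u"] cyc(1)[of "fst w" "fst u"] cyc(1)[of "fst w" "fst v"]
      cyc(2)[of "fst v" "fst u"] cyc(2)[of "fst w" "fst u"] cyc(2)[of "fst w" "fst v"]
      cyc(3)[of "fst v" "fst u"] cyc(3)[of "fst w" "fst u"] cyc(3)[of "fst w" "fst v"]
    by (simp add: wedge_def algebra_simps)
qed

section \<open>The five types in a uniform form\<close>

text \<open>
  The coefficients in \<open>de1 = k1 e23\<close>, \<open>de2 = k2 e13\<close>, \<open>de3 = k3 e12\<close>. The order \<open>e13\<close> rather than
  \<open>e31\<close> is the one in which the products occur in the fundamental forms.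
\<close>
definition k1 :: "bianchi \<Rightarrow> real" where
  "k1 B = (case B of Type_IX \<Rightarrow> -1 | Type_VIII \<Rightarrow> -1 | _ \<Rightarrow> 0)"
definition k2 :: "bianchi \<Rightarrow> real" where
  "k2 B = (case B of Type_II \<Rightarrow> 0 | _ \<Rightarrow> 1)"
definition k3 :: "bianchi \<Rightarrow> real" where
  "k3 B = (case B of Type_VIII \<Rightarrow> 1 | Type_VI0 \<Rightarrow> 1 | _ \<Rightarrow> -1)"

lemma k3_square: "k3 B * k3 B = 1"
  by (cases B) (simp_all add: k3_def)

lemma structure_equations_iff:
  "structure_equations B A e1 e2 e3 \<longleftrightarrow> (\<forall>c\<in>A. \<forall>x\<in>chart_image c. \<forall>u v.
     ext_deriv1 (e1 c) x u v = k1 B * wedge (e2 c x) (e3 c x) u v \<and>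
     ext_deriv1 (e2 c) x u v = k2 B * wedge (e1 c x) (e3 c x) u v \<and>
     ext_deriv1 (e3 c) x u v = k3 B * wedge (e1 c x) (e2 c x) u v)"
proof -
  have "- wedge (e3 c x) (e1 c x) u v = wedge (e1 c x) (e3 c x) u v" for c x u v
    by (simp add: wedge_def)
  then show ?thesis
    by (cases B) (auto simp: d_eq_def k1_def k2_def k3_def)
qed

lemma ode_system_iff:
  "ode_system B I f1 f2 f3 f \<longleftrightarrow> (\<forall>t\<in>I.
     ((\<lambda>s. f1 s * f2 s) has_real_derivative k3 B * (f t * f3 t)) (at t) \<and>
     ((\<lambda>s. f1 s * f3 s) has_real_derivative k2 B * (f t * f2 t)) (at t) \<and>
     ((\<lambda>s. f2 s * f3 s) has_real_derivative - k1 B * (f t * f1 t)) (at t))"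
  by (cases B) (simp_all add: k1_def k2_def k3_def)

section \<open>Integration of the systems\<close>

text \<open>
  Each equation of the system has the form \<open>g' = k x' / (2 g)\<close>, that is \<open>(g\<^sup>2)' = k x'\<close>. The
  reverse implication recovers \<open>g\<close> as a square root, so differentiability of \<open>g\<close> is part of the
  conclusion.
\<close>
lemma square_affine_iff:
  fixes g x x' :: "real \<Rightarrow> real"
  assumes I: "open I" "is_interval I" and pos: "\<And>t. t \<in> I \<Longrightarrow> g t > 0"
    and x: "\<And>t. t \<in> I \<Longrightarrow> (x has_real_derivative x' t) (at t)"
  shows "(\<forall>t\<in>I. (g has_real_derivative k * x' t / (2 * g t)) (at t)) \<longleftrightarrow>
    (\<exists>c. \<forall>t\<in>I. (g t)\<^sup>2 = c + k * x t)"
proof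
  assume g: "\<forall>t\<in>I. (g has_real_derivative k * x' t / (2 * g t)) (at t)"
  have "((\<lambda>t. (g t)\<^sup>2 - k * x t) has_real_derivative 0) (at t within I)" if "t \<in> I" for t
  proof -
    have "((\<lambda>t. (g t)\<^sup>2 - k * x t) has_real_derivative
        2 * g t * (k * x' t / (2 * g t)) - k * x' t) (at t)"
      using g x[OF that] that by (auto intro!: derivative_eq_intros)
    then show ?thesis using pos[OF that] by (simp add: has_field_derivative_at_within)
  qed
  then obtain c where "\<And>t. t \<in> I \<Longrightarrow> (g t)\<^sup>2 - k * x t = c"
    using has_field_derivative_zero_constant[of I "\<lambda>t. (g t)\<^sup>2 - k * x t"] I(2) is_interval_convex
    by blast
  then show "\<exists>c. \<forall>t\<in>I. (g t)\<^sup>2 = c + k * x t" by (metis diff_add_cancel)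
next
  assume "\<exists>c. \<forall>t\<in>I. (g t)\<^sup>2 = c + k * x t"
  then obtain c where c: "\<And>t. t \<in> I \<Longrightarrow> (g t)\<^sup>2 = c + k * x t" by blast
  show "\<forall>t\<in>I. (g has_real_derivative k * x' t / (2 * g t)) (at t)"
  proof
    fix t assume t: "t \<in> I"
    have g: "g s = sqrt (c + k * x s)" if "s \<in> I" for s
      using c[OF that] pos[OF that] by (metis less_imp_le real_sqrt_unique)
    have "c + k * x t > 0" using c[OF t] pos[OF t] by (metis zero_less_power)
    then have "((\<lambda>s. sqrt (c + k * x s)) has_real_derivative k * x' t / (2 * g t)) (at t)"
      using x[OF t] by (auto intro!: derivative_eq_intros simp: g[OF t] field_simps)
    then show "(g has_real_derivative k * x' t / (2 * g t)) (at t)"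
      by (rule has_field_derivative_transform_within_open[OF _ I(1) t]) (simp add: g)
  qed
qed

definition first_integrals :: "bianchi \<Rightarrow> real set \<Rightarrow>
    (real \<Rightarrow> real) \<Rightarrow> (real \<Rightarrow> real) \<Rightarrow> (real \<Rightarrow> real) \<Rightarrow> (real \<Rightarrow> real) \<Rightarrow> bool" where
  "first_integrals B I f1 f2 f3 f \<longleftrightarrow> (\<exists>c1 c2 c3 x. \<forall>t\<in>I.
     (x has_real_derivative 2 * (f t * f1 t * f2 t * f3 t)) (at t) \<and>
     (f2 t * f3 t)\<^sup>2 = c1 - k1 B * x t \<and>
     (f1 t * f3 t)\<^sup>2 = c2 + k2 B * x t \<and>
     (f1 t * f2 t)\<^sup>2 = c3 + k3 B * x t)"

text \<open>
  Once a primitive \<open>x\<close> of \<open>2 f f1 f2 f3\<close> is available, the claim is the preceding equivalence for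
  each of the three products. For a solution of the system such a primitive is
  \<open>k3 (f1 f2)\<^sup>2\<close>, because \<open>k3\<close> is a sign in all five types.
\<close>
lemma ode_system_iff_first_integrals:
  assumes I: "open I" "is_interval I" and pos: "\<And>t. t \<in> I \<Longrightarrow> f1 t > 0 \<and> f2 t > 0 \<and> f3 t > 0"
  shows "ode_system B I f1 f2 f3 f \<longleftrightarrow> first_integrals B I f1 f2 f3 f"
proof -
  let ?x' = "\<lambda>t. 2 * (f t * f1 t * f2 t * f3 t)"
  have iff: "ode_system B I f1 f2 f3 f \<longleftrightarrow>
      (\<exists>c. \<forall>t\<in>I. (f2 t * f3 t)\<^sup>2 = c + (- k1 B) * x t) \<and>
      (\<exists>c. \<forall>t\<in>I. (f1 t * f3 t)\<^sup>2 = c + k2 B * x t) \<and>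
      (\<exists>c. \<forall>t\<in>I. (f1 t * f2 t)\<^sup>2 = c + k3 B * x t)"
    if x: "\<And>t. t \<in> I \<Longrightarrow> (x has_real_derivative ?x' t) (at t)" for x
  proof -
    have eq: "k * (f t * f1 t) = k * ?x' t / (2 * (f2 t * f3 t))"
        "k * (f t * f2 t) = k * ?x' t / (2 * (f1 t * f3 t))"
        "k * (f t * f3 t) = k * ?x' t / (2 * (f1 t * f2 t))" if "t \<in> I" for t k
      using pos[OF that] by (simp_all add: field_simps)
    have "ode_system B I f1 f2 f3 f \<longleftrightarrow>
      (\<forall>t\<in>I. ((\<lambda>s. f2 s * f3 s) has_real_derivative (- k1 B) * ?x' t / (2 * (f2 t * f3 t))) (at t)) \<and>
      (\<forall>t\<in>I. ((\<lambda>s. f1 s * f3 s) has_real_derivative k2 B * ?x' t / (2 * (f1 t * f3 t))) (at t)) \<and>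
      (\<forall>t\<in>I. ((\<lambda>s. f1 s * f2 s) has_real_derivative k3 B * ?x' t / (2 * (f1 t * f2 t))) (at t))"
      unfolding ode_system_iff by (auto simp only: eq)
    also have "\<dots> \<longleftrightarrow>
      (\<exists>c. \<forall>t\<in>I. (f2 t * f3 t)\<^sup>2 = c + (- k1 B) * x t) \<and>
      (\<exists>c. \<forall>t\<in>I. (f1 t * f3 t)\<^sup>2 = c + k2 B * x t) \<and>
      (\<exists>c. \<forall>t\<in>I. (f1 t * f2 t)\<^sup>2 = c + k3 B * x t)"
      using pos by (intro conj_cong square_affine_iff[OF I _ x]) (auto simp: pos)
    finally show ?thesis .
  qed
  show ?thesis
  proof
    assume ode: "ode_system B I f1 f2 f3 f"
    define x where "x t = k3 B * (f1 t * f2 t)\<^sup>2" for t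
    have x: "(x has_real_derivative ?x' t) (at t)" if "t \<in> I" for t
    proof -
      have "(x has_real_derivative k3 B * (2 * (f1 t * f2 t) * (k3 B * (f t * f3 t)))) (at t)"
      proof -
        have d: "((\<lambda>s. f1 s * f2 s) has_real_derivative k3 B * (f t * f3 t)) (at t)"
          using ode that unfolding ode_system_iff by blast
        show ?thesis
          using DERIV_cmult[OF DERIV_mult[OF d d], of "k3 B"]
          by (simp add: x_def[abs_def] power2_eq_square algebra_simps)
      qed
      also have "k3 B * (2 * (f1 t * f2 t) * (k3 B * (f t * f3 t))) = (k3 B * k3 B) * ?x' t"
        by (simp only: mult_ac)
      finally show ?thesis by (simp add: k3_square)
    qed
    obtain c1 c2 c3 where "\<forall>t\<in>I. (f2 t * f3 t)\<^sup>2 = c1 + (- k1 B) * x t"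
        "\<forall>t\<in>I. (f1 t * f3 t)\<^sup>2 = c2 + k2 B * x t" "\<forall>t\<in>I. (f1 t * f2 t)\<^sup>2 = c3 + k3 B * x t"
      using ode iff[of x] x by blast
    then show "first_integrals B I f1 f2 f3 f"
      unfolding first_integrals_def using x
      by (intro exI[of _ c1] exI[of _ c2] exI[of _ c3] exI[of _ x]) simp
  next
    assume "first_integrals B I f1 f2 f3 f"
    then obtain c1 c2 c3 x where x: "\<forall>t\<in>I. (x has_real_derivative ?x' t) (at t) \<and>
        (f2 t * f3 t)\<^sup>2 = c1 - k1 B * x t \<and> (f1 t * f3 t)\<^sup>2 = c2 + k2 B * x t \<and>
        (f1 t * f2 t)\<^sup>2 = c3 + k3 B * x t"
      unfolding first_integrals_def by blast
    show "ode_system B I f1 f2 f3 f"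
      by (subst iff[of x]) (use x in \<open>auto intro!: exI[of _ c1] exI[of _ c2] exI[of _ c3]\<close>)
  qed
qed

lemma power_powr:
  fixes y :: real
  assumes "y > 0"
  shows "(y ^ n) powr a = y powr (real n * a)"
  using assms by (metis powr_powr powr_realpow)

lemma square_powr_quarter: "y > 0 \<Longrightarrow> (y\<^sup>2) powr (1/4) = sqrt y" for y :: real
  by (simp add: power_powr powr_half_sqrt)

text \<open>
  The monomial system \<open>f2 f3 = r\<^sup>2\<close>, \<open>f1 f3 = q\<^sup>2\<close>, \<open>f1 f2 = p\<^sup>2\<close> in positive numbers, where \<open>r\<close>, \<open>q\<close>, \<open>p\<close>
  are the fourth roots of \<open>R\<close>, \<open>Q\<close>, \<open>P\<close>, is solved by \<open>f1 = q p / r\<close> and its permutations; moreover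
  \<open>r q p = f1 f2 f3\<close>, which explains the factor in \<open>f\<close>.
\<close>
lemma quartic_roots_iff:
  fixes R Q P f1 f2 f3 f x' :: real
  shows "R > 0 \<and> Q > 0 \<and> P > 0 \<and>
      f1 = Q powr (1/4) * P powr (1/4) / R powr (1/4) \<and>
      f2 = R powr (1/4) * P powr (1/4) / Q powr (1/4) \<and>
      f3 = R powr (1/4) * Q powr (1/4) / P powr (1/4) \<and>
      f = 1/2 * (R * Q * P) powr (-1/4) * x'
    \<longleftrightarrow> f1 > 0 \<and> f2 > 0 \<and> f3 > 0 \<and>
      (f2 * f3)\<^sup>2 = R \<and> (f1 * f3)\<^sup>2 = Q \<and> (f1 * f2)\<^sup>2 = P \<and> x' = 2 * (f * f1 * f2 * f3)"
    (is "?L \<longleftrightarrow> ?R")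
proof -
  have weight: "((f2 * f3)\<^sup>2 * (f1 * f3)\<^sup>2 * (f1 * f2)\<^sup>2) powr (-1/4) = inverse (f1 * f2 * f3)"
    if "f1 > 0" "f2 > 0" "f3 > 0" for f1 f2 f3 :: real
  proof -
    let ?y = "f1 * f2 * f3"
    have "(f2 * f3)\<^sup>2 * (f1 * f3)\<^sup>2 * (f1 * f2)\<^sup>2 = ?y ^ 4"
      by (simp add: power2_eq_square power4_eq_xxxx algebra_simps)
    then show ?thesis using that by (simp add: power_powr powr_minus)
  qed
  have fwd: "f1 > 0 \<and> f2 > 0 \<and> f3 > 0 \<and> (f2 * f3)\<^sup>2 = R \<and> (f1 * f3)\<^sup>2 = Q \<and> (f1 * f2)\<^sup>2 = P" if ?L
  proof -
    define r q p where "r = R powr (1/4)" "q = Q powr (1/4)" "p = P powr (1/4)"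
    have pos: "r > 0" "q > 0" "p > 0" using that by (auto simp: r_q_p_def)
    have four: "R = r^4" "Q = q^4" "P = p^4"
      using that by (auto simp: r_q_p_def powr_power)
    have f: "f1 = q * p / r" "f2 = r * p / q" "f3 = r * q / p" using that by (auto simp: r_q_p_def)
    show ?thesis using pos unfolding f four
      by (simp add: power2_eq_square) (simp add: power4_eq_xxxx field_simps)
  qed
  show ?thesis
  proof
    assume ?L
    note sq = fwd[OF this]
    with weight[of f1 f2 f3] have "(R * Q * P) powr (-1/4) = inverse (f1 * f2 * f3)" by blast
    with \<open>?L\<close> have "f = 1/2 * inverse (f1 * f2 * f3) * x'" by simp
    moreover have "f1 \<noteq> 0" "f2 \<noteq> 0" "f3 \<noteq> 0" using sq by auto
    ultimately have "x' = 2 * (f * f1 * f2 * f3)" by (simp add: field_simps)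
    with sq show ?R by blast
  next
    assume R: ?R
    then have pos: "f1 > 0" "f2 > 0" "f3 > 0" by auto
    have "R > 0 \<and> Q > 0 \<and> P > 0" using R by auto
    moreover have rqp: "R powr (1/4) = sqrt f2 * sqrt f3" "Q powr (1/4) = sqrt f1 * sqrt f3"
        "P powr (1/4) = sqrt f1 * sqrt f2"
      using R square_powr_quarter[of "f2 * f3"] square_powr_quarter[of "f1 * f3"] square_powr_quarter[of "f1 * f2"] by (auto simp: real_sqrt_mult)
    moreover have "f = 1/2 * (R * Q * P) powr (-1/4) * x'"
      using R weight[OF pos] by (auto simp: field_simps)
    ultimately show ?L using pos by (simp add: field_simps)
  qed
qed

text \<open>
  The explicit formulas are those of the preceding lemma at \<open>R = c1 - k1 x\<close>, \<open>Q = c2 + k2 x\<close>,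
  \<open>P = c3 + k3 x\<close>, where the constants \<open>a1\<close>, \<open>a2\<close>, \<open>a3\<close> are the \<open>c1\<close>, \<open>c2\<close>, \<open>c3\<close> up to sign. For
  \<open>VII0\<close> and \<open>VI0\<close> the value \<open>R = a1\<close> is constant, and \<open>I\<close> has to be nonempty in order that a
  positivity condition at every point of \<open>I\<close> gives \<open>a1 > 0\<close>.
\<close>
lemma explicit_solution_iff_first_integrals:
  assumes "B \<noteq> Type_II" "I \<noteq> {}"
  shows "explicit_solution B I f1 f2 f3 f \<longleftrightarrow>
    (\<forall>t\<in>I. f1 t > 0 \<and> f2 t > 0 \<and> f3 t > 0) \<and> first_integrals B I f1 f2 f3 f"
proof -
  obtain t0 where t0: "t0 \<in> I" using \<open>I \<noteq> {}\<close> by blast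
  let ?x' = "\<lambda>t. 2 * (f t * f1 t * f2 t * f3 t)"
  let ?curve = "\<lambda>R Q P x x' t. (x has_real_derivative x' t) (at t) \<and> R t > 0 \<and> Q t > 0 \<and> P t > 0 \<and>
      f1 t = Q t powr (1/4) * P t powr (1/4) / R t powr (1/4) \<and>
      f2 t = R t powr (1/4) * P t powr (1/4) / Q t powr (1/4) \<and>
      f3 t = R t powr (1/4) * Q t powr (1/4) / P t powr (1/4) \<and>
      f t = 1/2 * (R t * Q t * P t) powr (-1/4) * x' t"
  have curve: "(\<exists>x'. \<forall>t\<in>I. ?curve R Q P x x' t) \<longleftrightarrow>
      (\<forall>t\<in>I. f1 t > 0 \<and> f2 t > 0 \<and> f3 t > 0) \<and>
      (\<forall>t\<in>I. (x has_real_derivative ?x' t) (at t) \<and> (f2 t * f3 t)\<^sup>2 = R t \<and>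
        (f1 t * f3 t)\<^sup>2 = Q t \<and> (f1 t * f2 t)\<^sup>2 = P t)" (is "?l \<longleftrightarrow> ?r")
    for R Q P x
  proof
    assume ?l
    then obtain x' where x': "\<forall>t\<in>I. ?curve R Q P x x' t" by blast
    then have "\<forall>t\<in>I. x' t = ?x' t" unfolding quartic_roots_iff by blast
    with x' show ?r unfolding quartic_roots_iff by simp
  next
    assume ?r
    then have "\<forall>t\<in>I. ?curve R Q P x ?x' t" unfolding quartic_roots_iff by simp
    then show ?l by (intro exI[of _ ?x'])
  qed
  have neg: "(\<exists>a b c. \<Phi> (- a) (- b) c) \<longleftrightarrow> (\<exists>a b c. \<Phi> a b c)"
      "(\<exists>a b c. \<Phi> (- a) (- b) (- c)) \<longleftrightarrow> (\<exists>a b c. \<Phi> a b c)"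
      "(\<exists>a b c. \<Phi> a (- b) c) \<longleftrightarrow> (\<exists>a b c. \<Phi> a b c)"
      "(\<exists>a b c. \<Phi> a (- b) (- c)) \<longleftrightarrow> (\<exists>a b c. \<Phi> a b c)"
    for \<Phi> :: "real \<Rightarrow> real \<Rightarrow> real \<Rightarrow> bool"
    by (metis minus_minus)+
  have form: "explicit_solution B I f1 f2 f3 f \<longleftrightarrow>
      (\<exists>c1 c2 c3 x x'. \<forall>t\<in>I. ?curve (\<lambda>t. c1 - k1 B * x t) (\<lambda>t. c2 + k2 B * x t) (\<lambda>t. c3 + k3 B * x t) x x' t)"
    (is "_ \<longleftrightarrow> (\<exists>c1 c2 c3. ?E c1 c2 c3)")
  proof -
    have coeff: "- a - (-1) * y = y - a" "- a + 1 * y = y - a" "a + (-1) * y = a - y" "a - 0 * y = a"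
      for a y :: real by simp_all
    have const_pos: "(\<forall>t\<in>I. D t \<and> 0 < a \<and> X t) \<longleftrightarrow> 0 < a \<and> (\<forall>t\<in>I. D t \<and> X t)"
      for D X :: "real \<Rightarrow> bool" and a :: real
      using t0 by blast
    note simps = explicit_solution.simps k1_def k2_def k3_def bianchi.case coeff const_pos
    show ?thesis
    proof (cases B)
      case Type_IX
      have "explicit_solution B I f1 f2 f3 f \<longleftrightarrow> (\<exists>a1 a2 a3. ?E (- a1) (- a2) a3)"
        unfolding Type_IX by (simp only: simps)
      also have "\<dots> \<longleftrightarrow> (\<exists>c1 c2 c3. ?E c1 c2 c3)" by (rule neg(1)[of ?E])
      finally show ?thesis .
    next
      case Type_VIII
      have "explicit_solution B I f1 f2 f3 f \<longleftrightarrow> (\<exists>a1 a2 a3. ?E (- a1) (- a2) (- a3))"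
        unfolding Type_VIII by (simp only: simps) (simp only: mult.commute)
      also have "\<dots> \<longleftrightarrow> (\<exists>c1 c2 c3. ?E c1 c2 c3)" by (rule neg(2)[of ?E])
      finally show ?thesis .
    next
      case Type_VII0
      have "explicit_solution B I f1 f2 f3 f \<longleftrightarrow> (\<exists>a1 a2 a3. ?E a1 (- a2) a3)"
        unfolding Type_VII0 by (simp only: simps)
      also have "\<dots> \<longleftrightarrow> (\<exists>c1 c2 c3. ?E c1 c2 c3)" by (rule neg(3)[of ?E])
      finally show ?thesis .
    next
      case Type_VI0
      have "explicit_solution B I f1 f2 f3 f \<longleftrightarrow> (\<exists>a1 a2 a3. ?E a1 (- a2) (- a3))"
        unfolding Type_VI0 by (simp only: simps)
      also have "\<dots> \<longleftrightarrow> (\<exists>c1 c2 c3. ?E c1 c2 c3)" by (rule neg(4)[of ?E])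
      finally show ?thesis .
    qed (use assms in simp)
  qed
  show ?thesis
    unfolding form curve first_integrals_def by blast
qed

text \<open>
  In type \<open>II\<close> the powers of \<open>u\<close> cancel in \<open>f1 f3\<close> and \<open>f2 f3\<close>, while \<open>f1 f2\<close> is \<open>u\<close> to the power \<open>2/3\<close>.
\<close>
lemma explicit_solution_II_imp_ode_system:
  assumes I: "open I" and expl: "explicit_solution Type_II I f1 f2 f3 f"
  shows "ode_system Type_II I f1 f2 f3 f"
proof -
  obtain a b c r u where ab: "a > 0" "b > 0" and sol: "\<And>t. t \<in> I \<Longrightarrow>
     u t = 3/2 * (a * b) powr (1/4) * r t + c \<and> u t > 0 \<and>
     f1 t = (b / a) powr (1/4) * u t powr (1/3) \<and>
     f2 t = (a / b) powr (1/4) * u t powr (1/3) \<and>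
     f3 t = - ((a * b) powr (1/4)) * u t powr (-1/3) \<and>
     (r has_real_derivative f t) (at t)"
    using expl unfolding explicit_solution.simps by blast
  define m where "m = (a * b) powr (1/4)"
  show ?thesis
    unfolding ode_system.simps
  proof (intro ballI conjI)
    fix t assume t: "t \<in> I"
    have u: "u t = 3/2 * m * r t + c" "u t > 0" and r: "(r has_real_derivative f t) (at t)"
      using sol[OF t] by (auto simp: m_def)
    have cancel: "u s powr (1/3) * u s powr (-1/3) = 1" if "s \<in> I" for s
      using sol[OF that] by (simp flip: powr_add)
    have "(b / a) powr (1/4) * (a / b) powr (1/4) = 1"
      using ab by (simp flip: powr_mult)
    then have f12: "f1 s * f2 s = (3/2 * m * r s + c) powr (2/3)" if "s \<in> I" for s
    proof -
      have "f1 s * f2 s = ((b / a) powr (1/4) * (a / b) powr (1/4)) * (u s powr (1/3) * u s powr (1/3))"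
        using sol[OF that] by (simp only: mult_ac)
      also have "\<dots> = u s powr (2/3)"
        using \<open>(b / a) powr (1/4) * (a / b) powr (1/4) = 1\<close> by (simp flip: powr_add)
      finally show ?thesis using sol[OF that] by (simp add: m_def)
    qed
    have "((\<lambda>s. (3/2 * m * r s + c) powr (2/3)) has_real_derivative
        (2/3) * u t powr (2/3 - 1) * (3/2 * m * f t)) (at t)"
      using r u by (auto intro!: derivative_eq_intros)
    also have "(2/3) * u t powr (2/3 - 1) * (3/2 * m * f t) = - (f t * f3 t)"
      using sol[OF t] by (simp add: m_def)
    finally show "((\<lambda>s. f1 s * f2 s) has_real_derivative - (f t * f3 t)) (at t)"
      by (rule has_field_derivative_transform_within_open[OF _ I t]) (simp add: f12)
    have "((\<lambda>s. - ((b / a) powr (1/4)) * m) has_real_derivative 0) (at t)" by simp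
    then show "((\<lambda>s. f1 s * f3 s) has_real_derivative 0) (at t)"
      by (rule has_field_derivative_transform_within_open[OF _ I t])
        (use sol cancel in \<open>simp add: m_def mult_ac\<close>)
    have "((\<lambda>s. - ((a / b) powr (1/4)) * m) has_real_derivative 0) (at t)" by simp
    then show "((\<lambda>s. f2 s * f3 s) has_real_derivative 0) (at t)"
      by (rule has_field_derivative_transform_within_open[OF _ I t])
        (use sol cancel in \<open>simp add: m_def mult_ac\<close>)
  qed
qed

text \<open>
  The constants \<open>b\<close> and \<open>a\<close> are the squares of the conserved products \<open>f1 f3\<close> and \<open>f2 f3\<close>; then
  \<open>b / a\<close> is the square of \<open>f1 / f2\<close>, and \<open>(a b) powr (1/4)\<close> is \<open>- f3 sqrt (f1 f2)\<close>. The affine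
  relation between \<open>u\<close> and \<open>r\<close> can be taken with \<open>c = 0\<close>.
\<close>
lemma ode_system_II_imp_explicit_solution:
  assumes I: "open I" "is_interval I" "I \<noteq> {}"
    and ode: "ode_system Type_II I f1 f2 f3 f"
    and sign: "\<And>t. t \<in> I \<Longrightarrow> f1 t > 0 \<and> f2 t > 0 \<and> f3 t < 0"
  shows "explicit_solution Type_II I f1 f2 f3 f"
proof -
  obtain t0 where t0: "t0 \<in> I" using I by blast
  have const: "\<exists>q. \<forall>t\<in>I. h t = q" if "\<And>t. t \<in> I \<Longrightarrow> (h has_real_derivative 0) (at t)" for h
    using has_field_derivative_zero_constant[of I h] that I is_interval_convex
    by (metis DERIV_subset top_greatest)
  obtain q where "\<forall>t\<in>I. f1 t * f3 t = q" using const[of "\<lambda>s. f1 s * f3 s"] ode by auto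
  moreover obtain p where "\<forall>t\<in>I. f2 t * f3 t = p" using const[of "\<lambda>s. f2 s * f3 s"] ode by auto
  ultimately have qp: "f1 t * (- f3 t) = - q" "f2 t * (- f3 t) = - p" if "t \<in> I" for t
    using that by auto
  have "- q > 0" "- p > 0"
    unfolding qp[OF t0, symmetric] using sign[OF t0] by (auto intro: mult_pos_neg)
  define a b where "a = p\<^sup>2" "b = q\<^sup>2"
  have ab: "a > 0" "b > 0" using \<open>- q > 0\<close> \<open>- p > 0\<close> by (auto simp: a_b_def)
  define m where "m = (a * b) powr (1/4)"
  have "m > 0" using ab by (simp add: m_def)
  define u where "u t = (f1 t * f2 t) powr (3/2)" for t
  define r where "r t = 2 / (3 * m) * u t" for t
  show ?thesis
    unfolding explicit_solution.simps
  proof (rule exI[of _ a], rule exI[of _ b], rule exI[of _ 0], rule exI[of _ r], rule exI[of _ u],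
      intro conjI ballI ab)
    fix t assume t: "t \<in> I"
    have s: "f1 t > 0" "f2 t > 0" "f3 t < 0" using sign[OF t] by auto
    have m: "m = sqrt (f1 t * f2 t) * (- f3 t)"
    proof -
      have "a * b = ((f1 t * f2 t) * (- f3 t)\<^sup>2)\<^sup>2"
        using qp[OF t] by (simp add: a_b_def power2_eq_square algebra_simps)
      then show ?thesis
        using s square_powr_quarter[of "(f1 t * f2 t) * (- f3 t)\<^sup>2"] by (simp add: m_def real_sqrt_mult)
    qed
    have u3: "u t powr (1/3) = sqrt (f1 t * f2 t)" "u t powr (-1/3) = inverse (sqrt (f1 t * f2 t))"
      using s by (simp_all add: u_def powr_powr powr_half_sqrt powr_minus)
    have ba: "(b / a) powr (1/4) = sqrt (f1 t / f2 t)" "(a / b) powr (1/4) = sqrt (f2 t / f1 t)"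
    proof -
      have "b / a = (f1 t / f2 t)\<^sup>2" "a / b = (f2 t / f1 t)\<^sup>2"
        using qp[OF t, symmetric] s by (simp_all add: a_b_def power_divide power_mult_distrib field_simps)
      then show "(b / a) powr (1/4) = sqrt (f1 t / f2 t)" "(a / b) powr (1/4) = sqrt (f2 t / f1 t)"
        using s square_powr_quarter[of "f1 t / f2 t"] square_powr_quarter[of "f2 t / f1 t"] by simp_all
    qed
    show "u t = 3/2 * (a * b) powr (1/4) * r t + 0"
      using \<open>m > 0\<close> by (simp add: r_def flip: m_def)
    show "u t > 0" using s by (simp add: u_def)
    show "f1 t = (b / a) powr (1/4) * u t powr (1/3)" "f2 t = (a / b) powr (1/4) * u t powr (1/3)"
      using s by (simp_all add: ba u3 real_sqrt_mult real_sqrt_divide)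
    show "f3 t = - ((a * b) powr (1/4)) * u t powr (-1/3)"
      unfolding u3(2) m_def[symmetric] using s by (simp add: m)
    have f12: "((\<lambda>s. f1 s * f2 s) has_real_derivative - (f t * f3 t)) (at t)"
      using ode t by auto
    have "((\<lambda>s. 2 / (3 * m) * (f1 s * f2 s) powr (3/2)) has_real_derivative
        2 / (3 * m) * ((3/2) * (f1 t * f2 t) powr (3/2 - 1) * (- (f t * f3 t)))) (at t)"
      using DERIV_cmult[OF DERIV_fun_powr[OF f12, of "3/2"], of "2 / (3 * m)"] s by simp
    also have "2 / (3 * m) * ((3/2) * (f1 t * f2 t) powr (3/2 - 1) * (- (f t * f3 t))) = f t"
      using s by (simp add: m powr_half_sqrt field_simps)
    finally show "(r has_real_derivative f t) (at t)" by (simp add: r_def[abs_def] u_def[abs_def])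
  qed
qed

lemma explicit_solution_imp_ode_system:
  assumes "open I" "is_interval I" "I \<noteq> {}" "explicit_solution B I f1 f2 f3 f"
  shows "ode_system B I f1 f2 f3 f"
proof (cases "B = Type_II")
  case True
  then show ?thesis using explicit_solution_II_imp_ode_system assms by blast
next
  case False
  then show ?thesis
    using assms explicit_solution_iff_first_integrals[of B I f1 f2 f3 f]
      ode_system_iff_first_integrals[of I f1 f2 f3 B f] by blast
qed

lemma ode_system_signs:
  assumes s: "s1 \<in> {-1, 1}" "s2 \<in> {-1, 1}" "s3 \<in> {-1, 1}"
    and ode: "ode_system B I f1 f2 f3 f"
  shows "ode_system B I (\<lambda>t. s1 * f1 t) (\<lambda>t. s2 * f2 t) (\<lambda>t. s3 * f3 t) (\<lambda>t. s1 * s2 * s3 * f t)"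
proof -
  have scaled: "((\<lambda>t. (s * g t) * (s' * h t)) has_real_derivative E) (at t)"
    if "((\<lambda>t. g t * h t) has_real_derivative D) (at t)" "E = s * s' * D"
    for g h :: "real \<Rightarrow> real" and s s' D E t
    using DERIV_cmult[OF that(1), of "s * s'"] that(2) by (simp add: mult_ac)
  have sq: "s1 * s1 = 1" "s2 * s2 = 1" "s3 * s3 = 1" using s by auto
  have prods: "k * (s1 * s2 * s3 * f t * (s3 * f3 t)) = (s3 * s3) * (s1 * s2 * (k * (f t * f3 t)))"
     "k * (s1 * s2 * s3 * f t * (s2 * f2 t)) = (s2 * s2) * (s1 * s3 * (k * (f t * f2 t)))"
     "k * (s1 * s2 * s3 * f t * (s1 * f1 t)) = (s1 * s1) * (s2 * s3 * (k * (f t * f1 t)))" for k t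
    by (simp_all only: mult_ac)
  show ?thesis
    using ode unfolding ode_system_iff prods sq by (auto intro!: scaled)
qed

lemma constant_sign:
  fixes g :: "real \<Rightarrow> real"
  assumes "is_interval I" "continuous_on I g" "\<forall>t\<in>I. g t \<noteq> 0"
  shows "\<exists>s\<in>{-1, 1}. \<forall>t\<in>I. s * g t > 0"
proof (rule ccontr)
  assume "\<not> ?thesis"
  then obtain t t' where t: "t \<in> I" "g t < 0" "t' \<in> I" "g t' > 0"
    using assms(3) by (auto simp: not_less) (metis less_eq_real_def)
  have "is_interval (g ` I)"
    using assms by (simp add: is_interval_connected_1 connected_continuous_image)
  then have "0 \<in> g ` I"
    using t unfolding is_interval_1 by (meson imageI less_imp_le)
  then show False using assms(3) by auto
qed

text \<open>
  The signs are chosen to make all three functions positive, except in type \<open>II\<close>, whose explicit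
  solution has \<open>f3 < 0\<close>.
\<close>
lemma ode_system_iff_general_solution:
  assumes I: "open I" "is_interval I" "I \<noteq> {}"
    and nz: "\<forall>t\<in>I. f1 t \<noteq> 0 \<and> f2 t \<noteq> 0 \<and> f3 t \<noteq> 0"
    and cont: "continuous_on I f1" "continuous_on I f2" "continuous_on I f3"
  shows "ode_system B I f1 f2 f3 f \<longleftrightarrow> general_solution B I f1 f2 f3 f"
proof
  assume ode: "ode_system B I f1 f2 f3 f"
  obtain s1 where s1: "s1 \<in> {-1, 1}" "\<forall>t\<in>I. s1 * f1 t > 0" using constant_sign[of I f1] I cont nz by blast
  obtain s2 where s2: "s2 \<in> {-1, 1}" "\<forall>t\<in>I. s2 * f2 t > 0" using constant_sign[of I f2] I cont nz by blast
  obtain s3 where s3: "s3 \<in> {-1, 1}" "\<forall>t\<in>I. s3 * f3 t > 0" using constant_sign[of I f3] I cont nz by blast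
  define s3' where "s3' = (if B = Type_II then - s3 else s3)"
  have s3': "s3' \<in> {-1, 1}" using s3 by (auto simp: s3'_def)
  note ode' = ode_system_signs[OF s1(1) s2(1) s3' ode]
  have "explicit_solution B I (\<lambda>t. s1 * f1 t) (\<lambda>t. s2 * f2 t) (\<lambda>t. s3' * f3 t) (\<lambda>t. s1 * s2 * s3' * f t)"
  proof (cases "B = Type_II")
    case True
    show ?thesis
      unfolding True using s1 s2 s3 ode'
      by (intro ode_system_II_imp_explicit_solution I) (auto simp: s3'_def True)
  next
    case False
    have pos: "s1 * f1 t > 0 \<and> s2 * f2 t > 0 \<and> s3' * f3 t > 0" if "t \<in> I" for t
      using s1 s2 s3 that False by (simp add: s3'_def)
    have "first_integrals B I (\<lambda>t. s1 * f1 t) (\<lambda>t. s2 * f2 t) (\<lambda>t. s3' * f3 t)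
        (\<lambda>t. s1 * s2 * s3' * f t)"
      using ode' by (subst (asm) ode_system_iff_first_integrals[OF I(1,2)]) (use pos in auto)
    then show ?thesis
      unfolding explicit_solution_iff_first_integrals[OF False I(3)] using pos by blast
  qed
  then show "general_solution B I f1 f2 f3 f"
    unfolding general_solution_def using s1(1) s2(1) s3' by blast
next
  assume "general_solution B I f1 f2 f3 f"
  then obtain s1 s2 s3 where s: "s1 \<in> {-1, 1}" "s2 \<in> {-1, 1}" "s3 \<in> {-1, 1}"
    and expl: "explicit_solution B I (\<lambda>t. s1 * f1 t) (\<lambda>t. s2 * f2 t) (\<lambda>t. s3 * f3 t)
      (\<lambda>t. s1 * s2 * s3 * f t)"
    unfolding general_solution_def by blast
  have sq: "s1 * (s1 * y) = y" "s2 * (s2 * y) = y" "s3 * (s3 * y) = y" for y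
    using s by auto
  have "s1 * s2 * s3 * (s1 * s2 * s3 * y) = s1 * (s1 * (s2 * (s2 * (s3 * (s3 * y)))))" for y
    by (simp only: mult_ac)
  then have "s1 * s2 * s3 * (s1 * s2 * s3 * y) = y" for y by (simp only: sq)
  then show "ode_system B I f1 f2 f3 f"
    using ode_system_signs[OF s explicit_solution_imp_ode_system[OF I expl]] by (simp only: sq)
qed

section \<open>The diagonal structure\<close>

text \<open>
  The endomorphisms act on the coordinates \<open>(E1, E2, E3, E4)\<close> by
  \<open>J = (- E2, E1, - E4, E3)\<close>, \<open>P1 = (E3, - E4, E1, - E2)\<close> and \<open>P2 = (E4, E3, E2, E1)\<close>, as read off
  from the three 2-forms.
\<close>
lemma hph_of_coframe_at:
  fixes E1 E2 E3 E4 :: "('c, 'v::euclidean_space) form1"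
  assumes "coframe4 (E1 c z) (E2 c z) (E3 c z) (E4 c z)"
  defines "S \<equiv> hph_of_coframe E1 E2 E3 E4"
  shows "hyper_parahermitian_at (metric S c z) (cplx S c z) (para1 S c z) (para2 S c z)"
    and "fundamental_form (metric S) (cplx S) c z = diag_Omega1 E1 E2 E3 E4 c z"
    and "fundamental_form (metric S) (para1 S) c z = diag_Omega2 E1 E2 E3 E4 c z"
    and "fundamental_form (metric S) (para2 S) c z = diag_Omega3 E1 E2 E3 E4 c z"
proof -
  interpret coframe4 "E1 c z" "E2 c z" "E3 c z" "E4 c z" by fact
  have metric: "diag_metric E1 E2 E3 E4 c z = g"
    by (simp add: diag_metric_def g_def fun_eq_iff)
  have J: "E1 c z (cplx S c z v) = - E2 c z v \<and> E2 c z (cplx S c z v) = E1 c z v \<and>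
      E3 c z (cplx S c z v) = - E4 c z v \<and> E4 c z (cplx S c z v) = E3 c z v" for v
    unfolding S_def hph_of_coframe_def endo_of_form_def hph_structure.simps metric
    by (rule represent) (simp add: diag_Omega1_def wedge_def algebra_simps)
  have P1: "E1 c z (para1 S c z v) = E3 c z v \<and> E2 c z (para1 S c z v) = - E4 c z v \<and>
      E3 c z (para1 S c z v) = E1 c z v \<and> E4 c z (para1 S c z v) = - E2 c z v" for v
    unfolding S_def hph_of_coframe_def endo_of_form_def hph_structure.simps metric
    by (rule represent) (simp add: diag_Omega2_def wedge_def algebra_simps)
  have P2: "E1 c z (para2 S c z v) = E4 c z v \<and> E2 c z (para2 S c z v) = E3 c z v \<and>
      E3 c z (para2 S c z v) = E2 c z v \<and> E4 c z (para2 S c z v) = E1 c z v" for v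
    unfolding S_def hph_of_coframe_def endo_of_form_def hph_structure.simps metric
    by (rule represent) (simp add: diag_Omega3_def wedge_def algebra_simps)
  have mS: "metric S c z = g"
    by (simp add: S_def hph_of_coframe_def metric)
  show "hyper_parahermitian_at (metric S c z) (cplx S c z) (para1 S c z) (para2 S c z)"
    unfolding mS by (rule hyper_parahermitian[OF J P1 P2])
  show "fundamental_form (metric S) (cplx S) c z = diag_Omega1 E1 E2 E3 E4 c z"
    by (simp add: fundamental_form_def mS g_def J diag_Omega1_def wedge_def fun_eq_iff algebra_simps)
  show "fundamental_form (metric S) (para1 S) c z = diag_Omega2 E1 E2 E3 E4 c z"
    by (simp add: fundamental_form_def mS g_def P1 diag_Omega2_def wedge_def fun_eq_iff algebra_simps)
  show "fundamental_form (metric S) (para2 S) c z = diag_Omega3 E1 E2 E3 E4 c z"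
    by (simp add: fundamental_form_def mS g_def P2 diag_Omega3_def wedge_def fun_eq_iff algebra_simps)
qed

lemma coframe4_scaled:
  fixes e1 e2 e3 :: "('c, real^3) form1"
  assumes lin: "linear (e1 c x)" "linear (e2 c x)" "linear (e3 c x)"
    and coords: "\<And>r1 r2 r3. \<exists>!v. e1 c x v = r1 \<and> e2 c x v = r2 \<and> e3 c x v = r3"
    and nz: "f1 t \<noteq> 0" "f2 t \<noteq> 0" "f3 t \<noteq> 0" "f t \<noteq> 0"
  shows "coframe4 (scaled_form f1 e1 c (x, t)) (scaled_form f2 e2 c (x, t))
    (scaled_form f3 e3 c (x, t)) (scaled_dt f c (x, t))"
proof (rule coframe4.intro)
  note linear_add[OF lin(1), simp] linear_add[OF lin(2), simp] linear_add[OF lin(3), simp]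
    linear_cmul[OF lin(1), simp] linear_cmul[OF lin(2), simp] linear_cmul[OF lin(3), simp]
  show "linear (scaled_form f1 e1 c (x, t))" "linear (scaled_form f2 e2 c (x, t))"
    "linear (scaled_form f3 e3 c (x, t))" "linear (scaled_dt f c (x, t))"
    by (auto intro!: linearI simp: scaled_form_def scaled_dt_def algebra_simps)
  fix r1 r2 r3 r4 :: real
  have eq: "h * y = r \<longleftrightarrow> y = r / h" if "h \<noteq> 0" for h y r :: real
    using that by (auto simp: field_simps)
  obtain v where v: "\<And>w. e1 c x w = r1 / f1 t \<and> e2 c x w = r2 / f2 t \<and> e3 c x w = r3 / f3 t \<longleftrightarrow> w = v"
    using coords[of "r1 / f1 t" "r2 / f2 t" "r3 / f3 t"] by (metis (no_types, lifting))
  have "scaled_form f1 e1 c (x, t) w = r1 \<and> scaled_form f2 e2 c (x, t) w = r2 \<and>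
      scaled_form f3 e3 c (x, t) w = r3 \<and> scaled_dt f c (x, t) w = r4 \<longleftrightarrow> w = (v, r4 / f t)" for w
    using v[of "fst w"] by (cases w) (auto simp: scaled_form_def scaled_dt_def eq nz)
  then show "\<exists>!w. scaled_form f1 e1 c (x, t) w = r1 \<and> scaled_form f2 e2 c (x, t) w = r2 \<and>
      scaled_form f3 e3 c (x, t) w = r3 \<and> scaled_dt f c (x, t) w = r4" by simp
qed simp

lemma smooth_form1_differentiable:
  assumes "smooth_form1 A \<alpha>" "c \<in> A" "open (chart_image c)" "x \<in> chart_image c"
  shows "(\<lambda>y. \<alpha> c y v) differentiable (at x)"
proof -
  have "smooth_on (\<lambda>y. \<alpha> c y v) (chart_image c)"
    using assms by (auto simp: smooth_form1_def)
  then have "Ck_on (Suc 0) (\<lambda>y. \<alpha> c y v) (chart_image c)"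
    unfolding smooth_on_def by blast
  then show ?thesis
    using assms by (auto simp: differentiable_on_eq_differentiable_at)
qed

text \<open>
  Closedness at a single point of \<open>G\<close>, where \<open>\<alpha> \<and> \<beta> \<noteq> 0\<close>, already forces the differential equation:
  its terms depend on \<open>t\<close> alone.
\<close>
lemma closed_form2_mixed_iff:
  fixes \<alpha> \<beta> \<gamma> :: "(('p, real^3) chart, real^3) form1"
  assumes "open I" and opn: "\<And>c. c \<in> A \<Longrightarrow> open (chart_image c)"
    and smooth: "smooth_form1 A \<alpha>" "smooth_form1 A \<beta>" "smooth_form1 A \<gamma>"
    and \<omega>: "\<And>c z u v. c \<in> A \<Longrightarrow> z \<in> chart_image c \<times> I \<Longrightarrow> \<omega> c z u v =
      F (snd z) * wedge (\<alpha> c (fst z)) (\<beta> c (fst z)) (fst u) (fst v)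
      + H (snd z) * (\<gamma> c (fst z) (fst u) * snd v - \<gamma> c (fst z) (fst v) * snd u)"
    and F: "\<And>t. t \<in> I \<Longrightarrow> (F has_real_derivative F' t) (at t)"
    and H: "\<And>t. t \<in> I \<Longrightarrow> H differentiable (at t)"
    and d: "\<And>c x u v. c \<in> A \<Longrightarrow> x \<in> chart_image c \<Longrightarrow>
        ext_deriv1 (\<alpha> c) x u v = k\<^sub>\<alpha> * wedge (\<beta> c x) (\<gamma> c x) u v \<and>
        ext_deriv1 (\<beta> c) x u v = k\<^sub>\<beta> * wedge (\<alpha> c x) (\<gamma> c x) u v \<and>
        ext_deriv1 (\<gamma> c) x u v = k\<^sub>\<gamma> * wedge (\<alpha> c x) (\<beta> c x) u v"
    and indep: "c0 \<in> A" "x0 \<in> chart_image c0" "wedge (\<alpha> c0 x0) (\<beta> c0 x0) u0 v0 \<noteq> 0"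
  shows "closed_form2 A I \<omega> \<longleftrightarrow> (\<forall>t\<in>I. F' t = - k\<^sub>\<gamma> * H t)"
proof -
  have ext: "ext_deriv2 (\<omega> c) (x, t) u v w = (F' t + k\<^sub>\<gamma> * H t) *
    (wedge (\<alpha> c x) (\<beta> c x) (fst u) (fst v) * snd w - wedge (\<alpha> c x) (\<beta> c x) (fst u) (fst w) * snd v
     + wedge (\<alpha> c x) (\<beta> c x) (fst v) (fst w) * snd u)"
    if "c \<in> A" "x \<in> chart_image c" "t \<in> I" for c x t u v w
  proof -
    obtain H' where H': "(H has_real_derivative H') (at t)"
      using H[OF \<open>t \<in> I\<close>] by (auto simp: real_differentiable_def)
    note differentiable = smooth_form1_differentiable[OF _ that(1) opn[OF that(1)] that(2)]
    show ?thesis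
    proof (rule ext_deriv2_mixed[where U = "chart_image c \<times> I" and F = F and H = H
          and \<gamma> = "\<gamma> c" and k\<^sub>\<alpha> = k\<^sub>\<alpha> and k\<^sub>\<beta> = k\<^sub>\<beta>])
      show "open (chart_image c \<times> I)" using opn that \<open>open I\<close> by (simp add: open_Times)
    qed (use that \<omega>[OF that(1)] d[OF that(1,2)] F H' differentiable smooth in simp_all)
  qed
  show ?thesis
  proof
    assume "closed_form2 A I \<omega>"
    then have "(F' t + k\<^sub>\<gamma> * H t) * wedge (\<alpha> c0 x0) (\<beta> c0 x0) u0 v0 = 0" if "t \<in> I" for t
      using ext[OF indep(1,2) that, of "(u0, 0)" "(v0, 0)" "(0, 1)"] indep that
      by (simp add: closed_form2_def)
    then show "\<forall>t\<in>I. F' t = - k\<^sub>\<gamma> * H t"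
      using indep(3) by (simp add: eq_neg_iff_add_eq_0)
  next
    assume "\<forall>t\<in>I. F' t = - k\<^sub>\<gamma> * H t"
    then show "closed_form2 A I \<omega>"
      by (auto simp: closed_form2_def ext)
  qed
qed

section \<open>Hyper-symplectic structures and the general solution\<close>

theorem mainTheorem2:
  fixes G :: "('p, 'more) monoid_scheme"
    and T :: "'p topology"
    and A :: "('p, real^3) chart set"
    and e1 e2 e3 :: "(('p, real^3) chart, real^3) form1"
    and B :: bianchi
    and I :: "real set"
    and f1 f2 f3 f :: "real \<Rightarrow> real"
  assumes "lie_group G T A"
    and "left_invariant_basis G A e1 e2 e3"
    and "structure_equations B A e1 e2 e3"
    and "open I" and "is_interval I" and "I \<noteq> {}"
    and "\<forall>t\<in>I. f1 t \<noteq> 0 \<and> f2 t \<noteq> 0 \<and> f3 t \<noteq> 0 \<and> f t \<noteq> 0"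
  shows "almost_hyper_parahermitian A I (diagonal_structure e1 e2 e3 f1 f2 f3 f)
    \<and> (f1 differentiable_on I \<and> f2 differentiable_on I \<and> f3 differentiable_on I \<and> f differentiable_on I \<longrightarrow>
         (hyper_symplectic A I (diagonal_structure e1 e2 e3 f1 f2 f3 f) \<longleftrightarrow> ode_system B I f1 f2 f3 f))
    \<and> (f1 differentiable_on I \<and> f2 differentiable_on I \<and> f3 differentiable_on I \<longrightarrow>
         (ode_system B I f1 f2 f3 f \<longleftrightarrow> general_solution B I f1 f2 f3 f))
    \<and> (explicit_solution B I f1 f2 f3 f \<longrightarrow> ode_system B I f1 f2 f3 f)
    \<and> (\<forall>c\<in>A. \<forall>x\<in>chart_image c. \<forall>t\<in>I. \<forall>v w s s'.
         metric (diagonal_structure e1 e2 e3 f1 f2 f3 f) c (x, t) (v, s) (w, s') =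
           (f1 t)\<^sup>2 * (e1 c x v * e1 c x w) + (f2 t)\<^sup>2 * (e2 c x v * e2 c x w)
           - (f3 t)\<^sup>2 * (e3 c x v * e3 c x w) - (f t)\<^sup>2 * (s * s'))"
proof (intro conjI impI)
  let ?S = "diagonal_structure e1 e2 e3 f1 f2 f3 f"
  interpret lie_group G T A by fact
  have smooth: "smooth_form1 A e1" "smooth_form1 A e2" "smooth_form1 A e3"
    using assms(2) by (auto simp: left_invariant_basis_def left_invariant_form1_def)
  then have lin: "linear (e1 c x)" "linear (e2 c x)" "linear (e3 c x)"
    if "c \<in> A" "x \<in> chart_image c" for c x
    using that by (auto simp: smooth_form1_def)
  have coords: "\<exists>!v. e1 c x v = r1 \<and> e2 c x v = r2 \<and> e3 c x v = r3"
    if "c \<in> A" "x \<in> chart_image c" for c x r1 r2 r3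
    using independent_functionals_coordinates[OF lin[OF that]]
      left_invariant_basis_independent[OF assms(1,2) that] by blast
  have coframe: "coframe4 (scaled_form f1 e1 c z) (scaled_form f2 e2 c z)
      (scaled_form f3 e3 c z) (scaled_dt f c z)" if "c \<in> A" "z \<in> chart_image c \<times> I" for c z
    using that assms(7) by (cases z) (auto intro!: coframe4_scaled lin coords)
  note at = hph_of_coframe_at[of "scaled_form f1 e1" _ _ "scaled_form f2 e2" "scaled_form f3 e3"
      "scaled_dt f", OF coframe]
  show almost: "almost_hyper_parahermitian A I ?S"
    unfolding almost_hyper_parahermitian_def diagonal_structure_def using at(1) by blast
  show "\<forall>c\<in>A. \<forall>x\<in>chart_image c. \<forall>t\<in>I. \<forall>v w s s'.
         metric ?S c (x, t) (v, s) (w, s') =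
           (f1 t)\<^sup>2 * (e1 c x v * e1 c x w) + (f2 t)\<^sup>2 * (e2 c x v * e2 c x w)
           - (f3 t)\<^sup>2 * (e3 c x v * e3 c x w) - (f t)\<^sup>2 * (s * s')"
    by (simp add: diagonal_structure_def hph_of_coframe_def diag_metric_def scaled_form_def
        scaled_dt_def power2_eq_square mult_ac)
  show "ode_system B I f1 f2 f3 f" if "explicit_solution B I f1 f2 f3 f"
    using explicit_solution_imp_ode_system assms that by blast
  show "ode_system B I f1 f2 f3 f \<longleftrightarrow> general_solution B I f1 f2 f3 f"
    if "f1 differentiable_on I \<and> f2 differentiable_on I \<and> f3 differentiable_on I"
    using that assms by (intro ode_system_iff_general_solution)
      (auto intro: differentiable_imp_continuous_on)
  show "hyper_symplectic A I ?S \<longleftrightarrow> ode_system B I f1 f2 f3 f"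
    if diff: "f1 differentiable_on I \<and> f2 differentiable_on I \<and> f3 differentiable_on I \<and> f differentiable_on I"
  proof -
    have D: "(h has_real_derivative deriv h t) (at t)" if "h differentiable_on I" "t \<in> I" for h t
      using that \<open>open I\<close>
      by (auto simp: differentiable_on_eq_differentiable_at DERIV_deriv_iff_real_differentiable)
    have D': "((\<lambda>s. g s * h s) has_real_derivative deriv g t * h t + deriv h t * g t) (at t)"
      if "g differentiable_on I" "h differentiable_on I" "t \<in> I" for g h t
      using DERIV_mult[OF D D] that by blast
    have ode: "((\<lambda>s. g s * h s) has_real_derivative y) (at t) \<longleftrightarrow> deriv g t * h t + deriv h t * g t = y"
      if "g differentiable_on I" "h differentiable_on I" "t \<in> I" for g h t y
      using D'[OF that] DERIV_unique by blast
    have prod: "(\<lambda>s. g s * h s) differentiable (at t)" "(\<lambda>s. - (g s * h s)) differentiable (at t)"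
      if "g differentiable_on I" "h differentiable_on I" "t \<in> I" for g h :: "real \<Rightarrow> real" and t
      using D'[OF that] DERIV_minus[OF D'[OF that]] by (auto simp: real_differentiable_def)
    obtain p where "p \<in> carrier G" by blast
    then obtain c0 where c0: "c0 \<in> A" "p \<in> fst c0"
      using charts_cover topspace_carrier by blast
    define x0 where "x0 = snd c0 p"
    have x0: "x0 \<in> chart_image c0" using c0 by (auto simp: x0_def chart_image_def)
    obtain b1 where b1: "e1 c0 x0 b1 = 1" "e2 c0 x0 b1 = 0" "e3 c0 x0 b1 = 0"
      using coords[OF c0(1) x0, of 1 0 0] by blast
    obtain b2 where b2: "e1 c0 x0 b2 = 0" "e2 c0 x0 b2 = 1" "e3 c0 x0 b2 = 0"
      using coords[OF c0(1) x0, of 0 1 0] by blast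
    obtain b3 where b3: "e1 c0 x0 b3 = 0" "e2 c0 x0 b3 = 0" "e3 c0 x0 b3 = 1"
      using coords[OF c0(1) x0, of 0 0 1] by blast
    have w: "wedge (e1 c0 x0) (e2 c0 x0) b1 b2 \<noteq> 0" "wedge (e1 c0 x0) (e3 c0 x0) b1 b3 \<noteq> 0"
      "wedge (e2 c0 x0) (e3 c0 x0) b2 b3 \<noteq> 0"
      by (simp_all add: wedge_def b1 b2 b3)
    have d: "ext_deriv1 (e1 c) x u v = k1 B * wedge (e2 c x) (e3 c x) u v"
        "ext_deriv1 (e2 c) x u v = k2 B * wedge (e1 c x) (e3 c x) u v"
        "ext_deriv1 (e3 c) x u v = k3 B * wedge (e1 c x) (e2 c x) u v"
      if "c \<in> A" "x \<in> chart_image c" for c x u v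
      using assms(3) that unfolding structure_equations_iff by auto
    have c1: "closed_form2 A I (fundamental_form (metric ?S) (cplx ?S)) \<longleftrightarrow>
      (\<forall>t\<in>I. - (deriv f1 t * f2 t + deriv f2 t * f1 t) = - k3 B * (f3 t * f t))"
    proof (rule closed_form2_mixed_iff[where \<alpha> = e1 and \<beta> = e2 and \<gamma> = e3
          and k\<^sub>\<alpha> = "k1 B" and k\<^sub>\<beta> = "k2 B" and F = "\<lambda>t. - (f1 t * f2 t)"])
      fix c z u v assume cz: "c \<in> A" "z \<in> chart_image c \<times> I"
      show "fundamental_form (metric ?S) (cplx ?S) c z u v =
        - (f1 (snd z) * f2 (snd z)) * wedge (e1 c (fst z)) (e2 c (fst z)) (fst u) (fst v)
        + f3 (snd z) * f (snd z) * (e3 c (fst z) (fst u) * snd v - e3 c (fst z) (fst v) * snd u)"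
        unfolding diagonal_structure_def at(2)[OF cz]
        by (simp add: diag_Omega1_def scaled_form_def scaled_dt_def wedge_def algebra_simps)
    next
      show "((\<lambda>t. - (f1 t * f2 t)) has_real_derivative
          - (deriv f1 t * f2 t + deriv f2 t * f1 t)) (at t)" if "t \<in> I" for t
        using DERIV_minus[OF D'] diff that by blast
    qed (use smooth \<open>open I\<close> chart_image_open d diff prod c0 x0 w in auto)
    have c2: "closed_form2 A I (fundamental_form (metric ?S) (para1 ?S)) \<longleftrightarrow>
      (\<forall>t\<in>I. deriv f1 t * f3 t + deriv f3 t * f1 t = - k2 B * (- (f2 t * f t)))"
    proof (rule closed_form2_mixed_iff[where \<alpha> = e1 and \<beta> = e3 and \<gamma> = e2
          and k\<^sub>\<alpha> = "- k1 B" and k\<^sub>\<beta> = "k3 B" and F = "\<lambda>t. f1 t * f3 t"])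
      fix c z u v assume cz: "c \<in> A" "z \<in> chart_image c \<times> I"
      show "fundamental_form (metric ?S) (para1 ?S) c z u v =
        f1 (snd z) * f3 (snd z) * wedge (e1 c (fst z)) (e3 c (fst z)) (fst u) (fst v)
        + - (f2 (snd z) * f (snd z)) * (e2 c (fst z) (fst u) * snd v - e2 c (fst z) (fst v) * snd u)"
        unfolding diagonal_structure_def at(3)[OF cz]
        by (simp add: diag_Omega2_def scaled_form_def scaled_dt_def wedge_def algebra_simps)
    qed (use smooth \<open>open I\<close> chart_image_open d diff D' prod c0 x0 w in
        \<open>auto simp: wedge_def algebra_simps\<close>)
    have c3: "closed_form2 A I (fundamental_form (metric ?S) (para2 ?S)) \<longleftrightarrow>
      (\<forall>t\<in>I. deriv f2 t * f3 t + deriv f3 t * f2 t = - k1 B * (f1 t * f t))"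
    proof (rule closed_form2_mixed_iff[where \<alpha> = e2 and \<beta> = e3 and \<gamma> = e1
          and k\<^sub>\<alpha> = "- k2 B" and k\<^sub>\<beta> = "- k3 B" and F = "\<lambda>t. f2 t * f3 t"])
      fix c z u v assume cz: "c \<in> A" "z \<in> chart_image c \<times> I"
      show "fundamental_form (metric ?S) (para2 ?S) c z u v =
        f2 (snd z) * f3 (snd z) * wedge (e2 c (fst z)) (e3 c (fst z)) (fst u) (fst v)
        + f1 (snd z) * f (snd z) * (e1 c (fst z) (fst u) * snd v - e1 c (fst z) (fst v) * snd u)"
        unfolding diagonal_structure_def at(4)[OF cz]
        by (simp add: diag_Omega3_def scaled_form_def scaled_dt_def wedge_def algebra_simps)
    qed (use smooth \<open>open I\<close> chart_image_open d diff D' prod c0 x0 w in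
        \<open>auto simp: wedge_def algebra_simps\<close>)
    show ?thesis
      unfolding hyper_symplectic_def c1 c2 c3 ode_system_iff
      using almost diff by (auto simp: ode mult.commute)
  qed
qed

end
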